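(* Let $0\le\underline{\sigma}<\overline{\sigma}<\infty$ and $0<\alpha\le 0.5$. Then $$\lim_{n\to\infty}\ \sup_{\{\sigma_i\}\in\Sigma(\underline{\sigma},\overline{\sigma})}\mathsf P\left(\sqrt n\,\bar X_n>\overline{\sigma}\,\Phi^{-1}(1-\alpha)\right)=\frac{2\alpha}{1+\underline{\sigma}/\overline{\sigma}}>\alpha .$$
   Context: $\Phi$ is the standard normal distribution function. Let $\epsilon_1,\epsilon_2,\dots$ be i.i.d. random variables on a probability space $(\Omega,\mathcal F,\mathsf P)$ with $\mathsf E(\epsilon_i)=0$, $\mathsf E(\epsilon_i^2)=1$, $\mathsf E(|\epsilon_i|^3)<\infty$, and let $\mathcal F_i=\sigma(\epsilon_1,\dots,\epsilon_i)$ ($\mathcal F_0$ trivial). $\Sigma(\underline{\sigma},\overline{\sigma})$ is the collection of all sequences $\{\sigma_i\}$ that are predictable (each $\sigma_i$ is $\mathcal F_{i-1}$-measurable) and take values in $[\underline{\sigma},\overline{\sigma}]$. For such a sequence, $X_i=\sigma_i\epsilon_i$ and $\bar X_n=(X_1+\cdots+X_n)/n$. *)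

theory Defs
  imports "HOL-Probability.Probability"
begin

text \<open>The distribution function of \<^const>\<open>std_normal_distribution\<close> is injective with range
  \<open>{0<..<1}\<close>, so \<open>inv\<close> is its genuine inverse there; other arguments give
  unspecified values.\<close>

definition std_normal_quantile :: "real \<Rightarrow> real" where
  "std_normal_quantile = inv (cdf std_normal_distribution)"

definition iid_vars :: "'a measure \<Rightarrow> (nat \<Rightarrow> 'a \<Rightarrow> real) \<Rightarrow> nat set \<Rightarrow> bool" where
  "iid_vars M X I \<longleftrightarrow> prob_space.indep_vars M (\<lambda>_. borel) X I \<and>
     (\<forall>i\<in>I. \<forall>j\<in>I. distr M borel (X i) = distr M borel (X j))"

text \<open>Sequences are indexed from 1; their value at index 0 plays no role. Only \<open>space\<close> and
  \<open>sets\<close> of \<open>natural_filtration M X i\<close> are meaningful, not its measure; at \<open>i = 0\<close> the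
  generator is empty, which gives the trivial \<open>\<sigma>\<close>-algebra.\<close>

definition natural_filtration :: "'a measure \<Rightarrow> (nat \<Rightarrow> 'a \<Rightarrow> real) \<Rightarrow> nat \<Rightarrow> 'a measure" where
  "natural_filtration M X i =
     sigma (space M) {X j -` B \<inter> space M | j B. j \<in> {1..i} \<and> B \<in> sets borel}"

definition predictable_seqs ::
  "'a measure \<Rightarrow> (nat \<Rightarrow> 'a \<Rightarrow> real) \<Rightarrow> real \<Rightarrow> real \<Rightarrow> (nat \<Rightarrow> 'a \<Rightarrow> real) set" where
  "predictable_seqs M \<epsilon> a b =
     {\<sigma>. \<forall>i\<ge>1. \<sigma> i \<in> borel_measurable (natural_filtration M \<epsilon> (i - 1)) \<and>
              (\<forall>\<omega>\<in>space M. \<sigma> i \<omega> \<in> {a..b})}"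

definition sample_mean :: "(nat \<Rightarrow> 'a \<Rightarrow> real) \<Rightarrow> nat \<Rightarrow> 'a \<Rightarrow> real" where
  "sample_mean X n \<omega> = (\<Sum>i=1..n. X i \<omega>) / real n"

end

theory Submission
  imports Defs
begin

text \<open>
  Write \<open>U(s, x)\<close> for the value, with time \<open>s\<close> to go, of controlling a Brownian motion with volatility in
  \<open>[a, b]\<close> so as to end above \<open>0\<close>. It is optimal to use \<open>b\<close> below \<open>0\<close> and \<open>a\<close> above \<open>0\<close>, and scaling gives
  \<open>U(s, x) = V(x / sqrt s)\<close> for an explicit \<open>V\<close> (named \<open>osc_val\<close>), glued from two rescaled copies of the
  normal distribution function. For \<open>a > 0\<close> the function \<open>V\<close> has a Lipschitz second derivative, so along
  the discrete random walk each step changes the expected value by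
  \<open>(\<sigma>\<^sup>2 - \<Gamma>\<^sup>2) V'' / (2 n s) + O(n powr (-3/2))\<close>, where \<open>\<Gamma>\<close> is the optimal volatility; the main term
  is never positive and vanishes for the optimal control. Two perturbations are needed: time is
  stopped \<open>\<delta>\<close> before maturity and the barrier is moved by \<open>\<eta>\<close>, since \<open>U\<close> is singular at \<open>s = 0\<close>; and
  \<open>V\<close> is built from some \<open>a\<close> strictly above the lower volatility bound \<open>l\<close>, since \<open>V\<close> has a kink for
  \<open>a = 0\<close>. The latter costs only \<open>O((a - l) / \<delta>)\<close>.
\<close>

section \<open>Standard normal distribution\<close>

abbreviation Phi :: "real \<Rightarrow> real" where
  "Phi \<equiv> cdf std_normal_distribution"

interpretation std_normal: real_distribution std_normal_distribution
  by (rule real_dist_normal_dist)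

lemma isCont_std_normal_density: "isCont std_normal_density x"
  unfolding std_normal_density_def[abs_def] by (intro continuous_intros) auto

lemma measure_std_normal_Ioc:
  assumes "x \<le> y"
  shows "measure std_normal_distribution {x<..y} = integral {x..y} std_normal_density"
proof -
  have int: "set_integrable lborel {x..y} std_normal_density"
    by (intro borel_integrable_atLeastAtMost' continuous_at_imp_continuous_on ballI
        isCont_std_normal_density)
  have "measure std_normal_distribution {x<..y} = (LINT t:{x<..y}|lborel. std_normal_density t)"
    unfolding measure_def set_lebesgue_integral_def
    by (subst emeasure_density)
       (auto simp: integral_eq_nn_integral mult.commute ennreal_mult' ennreal_indicator
         intro!: arg_cong[where f = enn2real] nn_integral_cong)
  also have "\<dots> = (LINT t:{x..y}|lborel. std_normal_density t)"
    unfolding set_lebesgue_integral_def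
    by (intro integral_cong_AE) (auto intro!: AE_I'[of "{x}"] simp: indicator_def)
  also have "\<dots> = integral {x..y} std_normal_density"
    by (rule set_borel_integral_eq_integral(2)[OF int])
  finally show ?thesis .
qed

text \<open>Near \<open>x\<close>, \<open>Phi\<close> is the constant \<open>Phi (x - 1)\<close>
  plus the integral of the density from \<open>x - 1\<close>, so the fundamental theorem of calculus
  applies; the base point \<open>x - 1\<close> keeps \<open>x\<close> in the interior of the
  interval.\<close>

lemma DERIV_Phi: "(Phi has_real_derivative std_normal_density x) (at x)"
proof -
  let ?F = "\<lambda>t. integral {x - 1..t} std_normal_density"
  have "(?F has_real_derivative std_normal_density x) (at x within {x - 1..x + 1})"
    by (rule integral_has_real_derivative)
       (auto intro!: continuous_at_imp_continuous_on isCont_std_normal_density)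
  then have "((\<lambda>t. Phi (x - 1) + ?F t) has_real_derivative std_normal_density x)
      (at x within {x - 1..x + 1})"
    by (auto intro!: derivative_eq_intros)
  then have "((\<lambda>t. Phi (x - 1) + ?F t) has_real_derivative std_normal_density x) (at x)"
    by (subst (asm) at_within_Icc_at) auto
  moreover have "eventually (\<lambda>t. Phi (x - 1) + ?F t = Phi t) (nhds x)"
  proof -
    have "eventually (\<lambda>t. t \<in> {x - 1<..}) (nhds x)"
      by (intro eventually_nhds_in_open) auto
    then show ?thesis
    proof eventually_elim
      case (elim t)
      then show ?case
        using std_normal.cdf_diff_eq[of "x - 1" t] measure_std_normal_Ioc[of "x - 1" t] by simp
    qed
  qed
  ultimately show ?thesis
    using DERIV_cong_ev[OF refl _ refl] by fast
qed

lemma DERIV_Phi_chain [derivative_intros]: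
  assumes "(g has_real_derivative g') (at x within A)"
    and "std_normal_density (g x) * g' = D"
  shows "((\<lambda>t. Phi (g t)) has_real_derivative D) (at x within A)"
  using DERIV_chain2[OF DERIV_Phi assms(1)] assms(2) by simp

lemma DERIV_std_normal_density [derivative_intros]:
  assumes "(g has_real_derivative g') (at x within A)"
    and "- g x * std_normal_density (g x) * g' = D"
  shows "((\<lambda>t. std_normal_density (g t)) has_real_derivative D) (at x within A)"
proof -
  have "(std_normal_density has_real_derivative - y * std_normal_density y) (at y)" for y
  proof -
    have "((\<lambda>y. c * exp (- y\<^sup>2 / 2)) has_real_derivative - y * (c * exp (- y\<^sup>2 / 2))) (at y)" for c
      by (auto intro!: derivative_eq_intros)
    then show ?thesis
      unfolding std_normal_density_def[abs_def] .
  qed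
  from DERIV_chain2[OF this assms(1)] assms(2) show ?thesis by simp
qed

lemma Phi_strict_mono: "x < y \<Longrightarrow> Phi x < Phi y"
  using DERIV_pos_imp_increasing[of x y Phi] DERIV_Phi normal_density_pos[of 1 0] by force

lemma isCont_Phi: "isCont Phi x"
  by (rule DERIV_isCont[OF DERIV_Phi])

lemma std_normal_density_minus: "std_normal_density (- x) = std_normal_density x"
  by (simp add: std_normal_density_def)

text \<open>The density is even, so \<open>Phi x + Phi (- x)\<close> has derivative 0; the constant
  is read off from the limit at infinity.\<close>

lemma Phi_minus: "Phi (- x) = 1 - Phi x"
proof -
  let ?f = "\<lambda>x. Phi x + Phi (- x)"
  have "(?f has_real_derivative 0) (at y)" for y
    by (auto intro!: derivative_eq_intros simp: std_normal_density_minus)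
  then have const: "?f y = ?f x" for y
    by (intro DERIV_isconst_all[of ?f]) auto
  have "(?f \<longlongrightarrow> 1 + 0) at_top"
    by (intro tendsto_add std_normal.cdf_lim_at_top_prob
        filterlim_compose[OF std_normal.cdf_lim_at_bot filterlim_uminus_at_bot_at_top])
  moreover have "?f = (\<lambda>_. ?f x)"
    using const by (rule ext)
  ultimately have "((\<lambda>_::real. ?f x) \<longlongrightarrow> 1) at_top"
    by (metis add_0_right)
  then have "?f x = 1"
    by (simp add: tendsto_const_iff)
  then show ?thesis by simp
qed

lemma Phi_0: "Phi 0 = 1 / 2"
  using Phi_minus[of 0] by simp

text \<open>\<open>inv\<close> yields a preimage as soon as one exists, and the limits at both ends
  together with the intermediate value theorem provide one.\<close>

lemma Phi_quantile:
  assumes "0 < p" "p < 1"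
  shows "Phi (std_normal_quantile p) = p"
proof -
  have "eventually (\<lambda>x. Phi x < p) at_bot" "eventually (\<lambda>x. p < Phi x) at_top"
    using order_tendstoD(2)[OF std_normal.cdf_lim_at_bot assms(1)]
      order_tendstoD(1)[OF std_normal.cdf_lim_at_top_prob assms(2)] .
  then obtain x y where xy: "Phi x < p" "p < Phi y"
    using eventually_happens[of "\<lambda>x. Phi x < p" at_bot]
      eventually_happens[of "\<lambda>x. p < Phi x" at_top] by auto
  then have "x \<le> y"
    using std_normal.cdf_nondecreasing[of y x] by linarith
  with xy obtain z where "Phi z = p"
    using IVT[of Phi x p y] isCont_Phi by force
  then show ?thesis
    unfolding std_normal_quantile_def by (intro f_inv_into_f) auto
qed

lemma quantile_nonneg:
  assumes "1 / 2 \<le> p" "p < 1"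
  shows "0 \<le> std_normal_quantile p"
proof (rule ccontr)
  assume "\<not> ?thesis"
  then have "Phi (std_normal_quantile p) < 1 / 2"
    using Phi_strict_mono[of _ 0] Phi_0 by simp
  with Phi_quantile[of p] assms show False by simp
qed

lemma std_normal_density_le: "std_normal_density x \<le> exp (- x\<^sup>2 / 2) / 2"
proof -
  have "2 \<le> sqrt (2 * pi)"
    by (rule real_le_rsqrt) (use pi_ge_two in auto)
  then show ?thesis
    unfolding std_normal_density_def by (auto simp: field_simps)
qed

text \<open>With \<open>z = x^2 / 2\<close>, the factor \<open>exp (- z)\<close> of the density
  reduces each bound to a polynomial in \<open>z\<close> against a multiple of \<open>exp z\<close>,
  settled by the quadratic Taylor bound. Odd powers are first replaced by averages of the
  neighbouring even ones.\<close>

lemma std_normal_density_moment_bounds: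
  shows "std_normal_density x \<le> 1 / 2"
    and "\<bar>x\<bar> * std_normal_density x \<le> 1 / 2"
    and "x\<^sup>2 * std_normal_density x \<le> 1"
    and "\<bar>x\<bar> ^ 3 * std_normal_density x \<le> 3"
proof -
  define z where "z = x\<^sup>2 / 2"
  have z: "0 \<le> z" unfolding z_def by simp
  have e: "1 + z + z\<^sup>2 / 2 \<le> exp z"
    using exp_lower_Taylor_quadratic[OF z] .
  have *: "p * std_normal_density x \<le> k / 2" if "0 \<le> p" "p \<le> k * exp z" for p k
  proof -
    have "p * std_normal_density x \<le> (k * exp z) * (exp (- z) / 2)"
      using that std_normal_density_le[of x] by (intro mult_mono) (auto simp: z_def)
    also have "\<dots> = k / 2"
      by (simp add: exp_minus)
    finally show ?thesis .
  qed
  have z2: "x\<^sup>2 = 2 * z" "x ^ 4 = 4 * z\<^sup>2"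
    unfolding z_def by (auto simp: power_divide)
  have x1: "\<bar>x\<bar> \<le> (1 + x\<^sup>2) / 2"
    using zero_le_power2[of "\<bar>x\<bar> - 1"] by (simp add: power2_diff)
  have "0 \<le> x\<^sup>2 * (\<bar>x\<bar> - 1)\<^sup>2"
    by simp
  also have "\<dots> = x\<^sup>2 + x ^ 4 - 2 * \<bar>x\<bar> ^ 3"
    by (cases "x \<ge> 0") (auto simp: power2_eq_square power3_eq_cube power4_eq_xxxx algebra_simps)
  finally have x3: "\<bar>x\<bar> ^ 3 \<le> (x\<^sup>2 + x ^ 4) / 2" by simp
  have zz: "0 \<le> z\<^sup>2" by simp
  show "std_normal_density x \<le> 1 / 2"
    using *[of 1 1] z by simp
  show "\<bar>x\<bar> * std_normal_density x \<le> 1 / 2"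
  proof -
    have "\<bar>x\<bar> \<le> 1 / 2 + z"
      using x1 unfolding z2 by simp
    also have "\<dots> \<le> 1 * exp z"
      unfolding mult_1 using z e zz by linarith
    finally have "\<bar>x\<bar> \<le> 1 * exp z" .
    then show ?thesis
      using *[of "\<bar>x\<bar>" 1] by simp
  qed
  show "x\<^sup>2 * std_normal_density x \<le> 1"
    using *[of "x\<^sup>2" 2] z e zz unfolding z2 by simp
  show "\<bar>x\<bar> ^ 3 * std_normal_density x \<le> 3"
  proof -
    have "\<bar>x\<bar> ^ 3 \<le> z + 2 * z\<^sup>2"
      using x3 unfolding z2 by simp
    also have "\<dots> \<le> 6 * exp z"
      using z e zz by linarith
    finally have "\<bar>x\<bar> ^ 3 \<le> 6 * exp z" .
    then show ?thesis
      using *[of "\<bar>x\<bar> ^ 3" 6] by simp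
  qed
qed

section \<open>Taylor estimates from Lipschitz derivatives\<close>

lemma MVT_both:
  fixes f f' :: "real \<Rightarrow> real"
  assumes "\<And>z. min x y \<le> z \<Longrightarrow> z \<le> max x y \<Longrightarrow> (f has_real_derivative f' z) (at z)"
  obtains z where "f y - f x = (y - x) * f' z" "\<bar>z - x\<bar> \<le> \<bar>y - x\<bar>"
    "min x y \<le> z" "z \<le> max x y"
proof (cases x y rule: linorder_cases)
  case less
  then obtain z where "x < z" "z < y" "f y - f x = (y - x) * f' z"
    using MVT2[of x y f f'] assms by auto
  then show ?thesis by (intro that[of z]) auto
next
  case equal
  then show ?thesis by (intro that[of x]) auto
next
  case greater
  then obtain z where "y < z" "z < x" "f x - f y = (x - y) * f' z"
    using MVT2[of y x f f'] assms by auto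
  then show ?thesis by (intro that[of z]) (auto simp: algebra_simps)
qed

text \<open>The mean value theorem turns the remainder into \<open>(y - x) * (f' z - f' x)\<close>,
  so a Lipschitz bound centred at \<open>x\<close> takes the place of a second derivative.\<close>

lemma taylor1_lipschitz:
  fixes f f' :: "real \<Rightarrow> real"
  assumes "\<And>z. min x y \<le> z \<Longrightarrow> z \<le> max x y \<Longrightarrow> (f has_real_derivative f' z) (at z)"
    and "\<And>z. min x y \<le> z \<Longrightarrow> z \<le> max x y \<Longrightarrow> \<bar>f' z - f' x\<bar> \<le> L * \<bar>z - x\<bar>" and "0 \<le> L"
  shows "\<bar>f y - f x - (y - x) * f' x\<bar> \<le> L * (y - x)\<^sup>2"
proof -
  obtain z where z: "f y - f x = (y - x) * f' z" "\<bar>z - x\<bar> \<le> \<bar>y - x\<bar>"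
    "min x y \<le> z" "z \<le> max x y"
    using MVT_both[of x y f f'] assms(1) by blast
  have "\<bar>f y - f x - (y - x) * f' x\<bar> = \<bar>y - x\<bar> * \<bar>f' z - f' x\<bar>"
    by (simp add: z(1) abs_mult[symmetric] right_diff_distrib)
  also have "\<dots> \<le> \<bar>y - x\<bar> * (L * \<bar>y - x\<bar>)"
    using assms(2)[OF z(3,4)] mult_left_mono[OF z(2) assms(3)] by (intro mult_left_mono) auto
  also have "\<dots> = L * (y - x)\<^sup>2"
    by (simp add: power2_eq_square flip: abs_mult)
  finally show ?thesis .
qed

text \<open>Meant for \<open>osc_val\<close>, whose second derivative is Lipschitz but has a corner
  at 0 if \<open>a < b\<close>. The remainder, as a function of the increment, has a derivative
  controlled by \<open>taylor1_lipschitz\<close>; the mean value theorem supplies the third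
  power.\<close>

lemma taylor2_lipschitz:
  fixes f f' f'' :: "real \<Rightarrow> real"
  assumes f: "\<And>z. (f has_real_derivative f' z) (at z)"
    and f': "\<And>z. (f' has_real_derivative f'' z) (at z)"
    and lip: "\<And>z y. \<bar>f'' z - f'' y\<bar> \<le> L * \<bar>z - y\<bar>" and "0 \<le> L"
  shows "\<bar>f (x + w) - f x - f' x * w - f'' x * w\<^sup>2 / 2\<bar> \<le> L * \<bar>w\<bar> ^ 3"
proof -
  let ?g = "\<lambda>v. f (x + v) - f' x * v - f'' x * v\<^sup>2 / 2"
  let ?g' = "\<lambda>v. f' (x + v) - f' x - f'' x * v"
  have "((\<lambda>v. f (x + v)) has_real_derivative f' (x + v)) (at v)" for v
    using f[of "v + x"] unfolding DERIV_shift by (simp only: add.commute)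
  then have "(?g has_real_derivative ?g' v) (at v)" for v
    by (auto intro!: derivative_eq_intros)
  then obtain v where v: "?g w - ?g 0 = (w - 0) * ?g' v" "\<bar>v - 0\<bar> \<le> \<bar>w - 0\<bar>"
    using MVT_both[of 0 w ?g ?g'] by blast
  have "\<bar>?g' v\<bar> \<le> L * v\<^sup>2"
    using taylor1_lipschitz[of x "x + v" f' f'' L] f' lip \<open>0 \<le> L\<close>
    by (simp add: mult.commute)
  also have "\<dots> \<le> L * w\<^sup>2"
    using v(2) \<open>0 \<le> L\<close> by (intro mult_left_mono) (auto simp: abs_le_square_iff)
  finally have "\<bar>w\<bar> * \<bar>?g' v\<bar> \<le> \<bar>w\<bar> * (L * w\<^sup>2)"
    by (intro mult_left_mono) auto
  also have "\<dots> = L * \<bar>w\<bar> ^ 3"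
    by (simp add: power3_eq_cube power2_eq_square abs_mult[symmetric])
  finally have "\<bar>w * ?g' v\<bar> \<le> L * \<bar>w\<bar> ^ 3"
    by (simp only: abs_mult)
  moreover have "f (x + w) - f x - f' x * w - f'' x * w\<^sup>2 / 2 = w * ?g' v"
    using v(1) by simp
  ultimately show ?thesis
    by (simp only:)
qed

section \<open>Value function of the limiting control problem\<close>

lemma DERIV_glue_at_0:
  fixes f g :: "real \<Rightarrow> real"
  assumes f: "\<And>z. (f has_real_derivative f' z) (at z)"
    and g: "\<And>z. (g has_real_derivative g' z) (at z)"
    and "f 0 = g 0" "f' 0 = g' 0"
  shows "((\<lambda>y. if y \<le> 0 then f y else g y) has_real_derivative (if y \<le> 0 then f' y else g' y)) (at y)"
proof -
  have "((\<lambda>y. if y \<in> {..0} then f y else g y) has_vector_derivative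
      (if y \<in> {..0} then f' y else g' y)) (at y within UNIV)"
  proof (rule has_vector_derivative_If_within_closures[where T = "{0<..}"])
    show "y \<in> {..0} \<union> {0<..}" by auto
    show "(UNIV :: real set) = {..0} \<union> {0<..}" by auto
  qed (use assms in \<open>auto simp: has_real_derivative_iff_has_vector_derivative
      intro: has_vector_derivative_at_within\<close>)
  then show ?thesis
    by (simp add: has_real_derivative_iff_has_vector_derivative)
qed

text \<open>For points on opposite sides of 0, pass through the common value at 0: the two distances
  to 0 add up to the distance of the points.\<close>

lemma lipschitz_glue_at_0:
  fixes f g :: "real \<Rightarrow> real"
  assumes f: "\<And>x y. \<bar>f x - f y\<bar> \<le> L * \<bar>x - y\<bar>"
    and g: "\<And>x y. \<bar>g x - g y\<bar> \<le> L * \<bar>x - y\<bar>" and 0: "f 0 = g 0"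
  defines "h \<equiv> \<lambda>x. if x \<le> 0 then f x else g x"
  shows "\<bar>h x - h y\<bar> \<le> L * \<bar>x - y\<bar>"
proof -
  have *: "\<bar>f x - g y\<bar> \<le> L * (y - x)" if "x \<le> 0" "0 < y" for x y
    using f[of x 0] g[of 0 y] 0 that by (simp add: right_diff_distrib)
  show ?thesis
    using f g *[of x y] *[of y x] unfolding h_def by (auto simp: abs_minus_commute)
qed

lemma DERIV_scaled_Phi:
  assumes "k \<noteq> 0"
  shows "((\<lambda>y. c * k * Phi (y / k)) has_real_derivative c * std_normal_density (y / k)) (at y)"
  using assms by (auto intro!: derivative_eq_intros)

lemma DERIV_scaled_density:
  assumes "k \<noteq> 0"
  shows "((\<lambda>y. c * std_normal_density (y / k)) has_real_derivative
    - (c * (y / k\<^sup>2) * std_normal_density (y / k))) (at y)"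
  using assms by (auto intro!: derivative_eq_intros simp: power2_eq_square)

text \<open>A Taylor expansion in \<open>t\<close> whose error is uniform in \<open>z\<close>. Since
  \<open>q' = - q / (2 (1 + v))\<close>, the first two derivatives are combinations of
  \<open>q\<close> and \<open>q^3\<close> times the density, with coefficients bounded in
  \<open>v\<close>, so the moment bounds apply. The linear term is \<open>t / 2\<close> times the
  second derivative of \<open>Phi\<close>, as in the heat equation.\<close>

lemma heat_time_expansion:
  assumes "0 \<le> t"
  shows "\<bar>Phi (z / sqrt (1 + t)) - Phi z + t / 2 * (z * std_normal_density z)\<bar> \<le> 2 * t\<^sup>2"
proof -
  define q where "q = (\<lambda>v. z / sqrt (1 + v))"
  define g' where "g' = (\<lambda>v. - (1 / (2 * (1 + v))) * (q v * std_normal_density (q v)))"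
  define g'' where "g'' = (\<lambda>v. 1 / (1 + v)\<^sup>2 * (3 / 4 * (q v * std_normal_density (q v))
    - 1 / 4 * (q v ^ 3 * std_normal_density (q v))))"
  have q: "(q has_real_derivative - (q v / (2 * (1 + v)))) (at v)" if "0 \<le> v" for v
  proof -
    have "(q has_real_derivative - (z * (inverse (sqrt (1 + v)) / 2) / (sqrt (1 + v) * sqrt (1 + v)))) (at v)"
      unfolding q_def using that
      by (auto intro!: derivative_eq_intros simp: field_simps)
    also have "z * (inverse (sqrt (1 + v)) / 2) / (sqrt (1 + v) * sqrt (1 + v)) = q v / (2 * (1 + v))"
      unfolding q_def using that by (simp add: field_simps)
    finally show ?thesis .
  qed
  have g: "((\<lambda>v. Phi (q v)) has_real_derivative g' v) (at v)" if "0 \<le> v" for v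
    unfolding g'_def using q[OF that] by (auto intro!: derivative_eq_intros simp: field_simps)
  have gg: "(g' has_real_derivative g'' v) (at v)" if "0 \<le> v" for v
  proof -
    define s where "s = 1 + v"
    define p where "p = std_normal_density (q v)"
    have "s \<noteq> 0"
      unfolding s_def using that by simp
    have "((\<lambda>v. - (1 / (2 * (1 + v)))) has_real_derivative 1 / (2 * s\<^sup>2)) (at v)"
      using that unfolding s_def
      by (auto intro!: derivative_eq_intros simp: power2_eq_square divide_simps)
         (simp add: algebra_simps)
    moreover have "((\<lambda>v. q v * std_normal_density (q v)) has_real_derivative
        - (q v / (2 * s)) * p + - q v * p * - (q v / (2 * s)) * q v) (at v)"
      unfolding s_def p_def
      by (intro DERIV_mult q[OF that] DERIV_std_normal_density[OF q[OF that] refl])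
    ultimately have "(g' has_real_derivative 1 / (2 * s\<^sup>2) * (q v * p)
        + (- (q v / (2 * s)) * p + - q v * p * - (q v / (2 * s)) * q v) * - (1 / (2 * s))) (at v)"
      unfolding g'_def s_def p_def by (rule DERIV_mult)
    also have "1 / (2 * s\<^sup>2) * (q v * p)
        + (- (q v / (2 * s)) * p + - q v * p * - (q v / (2 * s)) * q v) * - (1 / (2 * s)) = g'' v"
      unfolding g''_def s_def[symmetric] p_def[symmetric] using \<open>s \<noteq> 0\<close>
      by (simp add: divide_simps power2_eq_square power3_eq_cube)
    finally show ?thesis .
  qed
  have g''_bound: "\<bar>g'' v\<bar> \<le> 2" if "0 \<le> v" for v
  proof -
    have "\<bar>3 / 4 * (q v * std_normal_density (q v)) - 1 / 4 * (q v ^ 3 * std_normal_density (q v))\<bar>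
      \<le> 3 / 4 * \<bar>q v * std_normal_density (q v)\<bar> + 1 / 4 * \<bar>q v ^ 3 * std_normal_density (q v)\<bar>"
      by (simp add: abs_mult flip: abs_mult)
    also have "\<dots> \<le> 2"
      using std_normal_density_moment_bounds[of "q v"]
      by (simp add: abs_mult power_abs)
    finally have *: "\<bar>3 / 4 * (q v * std_normal_density (q v))
        - 1 / 4 * (q v ^ 3 * std_normal_density (q v))\<bar> \<le> 2" .
    have "\<bar>1 / (1 + v)\<^sup>2\<bar> \<le> 1"
      using that by (simp add: field_simps)
    then show ?thesis
      unfolding g''_def abs_mult[of "1 / (1 + v)\<^sup>2"] using mult_mono[OF _ *] by fastforce
  qed
  have lip: "\<bar>g' v - g' 0\<bar> \<le> 2 * \<bar>v - 0\<bar>" if v: "0 \<le> v" for v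
  proof -
    obtain x where x: "g' v - g' 0 = (v - 0) * g'' x" "min 0 v \<le> x"
      using MVT_both[of 0 v g' g''] gg v by (metis min_absorb1)
    then have "\<bar>g' v - g' 0\<bar> = \<bar>v\<bar> * \<bar>g'' x\<bar>"
      by (simp add: abs_mult)
    also have "\<dots> \<le> \<bar>v\<bar> * 2"
      using g''_bound[of x] x(2) v by (intro mult_left_mono) auto
    finally show ?thesis by simp
  qed
  have "\<bar>Phi (q t) - Phi (q 0) - (t - 0) * g' 0\<bar> \<le> 2 * (t - 0)\<^sup>2"
    using assms by (intro taylor1_lipschitz[where f' = g' and f = "\<lambda>v. Phi (q v)"] g lip) auto
  then show ?thesis
    by (simp add: q_def g'_def)
qed

section \<open>The value function and its derivatives\<close>

definition osc_scale :: "real \<Rightarrow> real \<Rightarrow> real \<Rightarrow> real" where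
  "osc_scale a b y = (if y \<le> 0 then b else a)"

text \<open>The probability that oscillating Brownian motion, with volatility \<open>b\<close> below
  0 and \<open>a\<close> above, is positive at time 1 when started at \<open>y\<close>. The factors
  give both pieces the same slope at 0, and the additive constant makes both values there
  \<open>b / (a + b)\<close>.\<close>

definition osc_val :: "real \<Rightarrow> real \<Rightarrow> real \<Rightarrow> real" where
  "osc_val a b y = (if y \<le> 0 then 2 * b / (a + b) * Phi (y / b)
     else (b - a) / (a + b) + 2 * a / (a + b) * Phi (y / a))"

definition osc_val' :: "real \<Rightarrow> real \<Rightarrow> real \<Rightarrow> real" where
  "osc_val' a b y = 2 / (a + b) * std_normal_density (y / osc_scale a b y)"

definition osc_val'' :: "real \<Rightarrow> real \<Rightarrow> real \<Rightarrow> real" where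
  "osc_val'' a b y = - (2 / (a + b) * (y / (osc_scale a b y)\<^sup>2)
     * std_normal_density (y / osc_scale a b y))"

locale osc =
  fixes a b :: real
  assumes a_pos: "0 < a" and a_le_b: "a \<le> b"
begin

lemma b_pos: "0 < b" and ab_pos: "0 < a + b"
  using a_pos a_le_b by auto

lemma osc_scale_bounds: "a \<le> osc_scale a b y" "osc_scale a b y \<le> b" "0 < osc_scale a b y"
  unfolding osc_scale_def using a_pos a_le_b by auto

lemma DERIV_osc_val: "(osc_val a b has_real_derivative osc_val' a b y) (at y)"
proof -
  have "((\<lambda>y. if y \<le> 0 then 2 * b / (a + b) * Phi (y / b)
      else (b - a) / (a + b) + 2 * a / (a + b) * Phi (y / a)) has_real_derivative
      (if y \<le> 0 then 2 / (a + b) * std_normal_density (y / b)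
       else 2 / (a + b) * std_normal_density (y / a))) (at y)"
  proof (rule DERIV_glue_at_0)
    show "((\<lambda>y. 2 * b / (a + b) * Phi (y / b)) has_real_derivative
        2 / (a + b) * std_normal_density (z / b)) (at z)" for z
      using DERIV_scaled_Phi[of b "2 / (a + b)" z] b_pos by simp
    show "((\<lambda>y. (b - a) / (a + b) + 2 * a / (a + b) * Phi (y / a)) has_real_derivative
        2 / (a + b) * std_normal_density (z / a)) (at z)" for z
      using DERIV_add[OF DERIV_const DERIV_scaled_Phi[of a "2 / (a + b)" z]] a_pos by simp
    show "2 * b / (a + b) * Phi (0 / b) = (b - a) / (a + b) + 2 * a / (a + b) * Phi (0 / a)"
      using ab_pos by (simp add: Phi_0 divide_simps) (simp add: algebra_simps)
  qed simp
  then show ?thesis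
    unfolding osc_val_def[abs_def] osc_val'_def osc_scale_def by (simp split: if_splits)
qed

lemma DERIV_osc_val': "(osc_val' a b has_real_derivative osc_val'' a b y) (at y)"
proof -
  have "((\<lambda>y. if y \<le> 0 then 2 / (a + b) * std_normal_density (y / b)
       else 2 / (a + b) * std_normal_density (y / a)) has_real_derivative
      (if y \<le> 0 then - (2 / (a + b) * (y / b\<^sup>2) * std_normal_density (y / b))
       else - (2 / (a + b) * (y / a\<^sup>2) * std_normal_density (y / a)))) (at y)"
    using a_pos b_pos by (intro DERIV_glue_at_0 DERIV_scaled_density) auto
  moreover have "osc_val' a b = (\<lambda>y. if y \<le> 0 then 2 / (a + b) * std_normal_density (y / b)
       else 2 / (a + b) * std_normal_density (y / a))"
    unfolding osc_val'_def osc_scale_def by auto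
  ultimately show ?thesis
    unfolding osc_val''_def osc_scale_def by (simp split: if_splits)
qed

text \<open>Both pieces carry a factor \<open>y\<close>, hence agree at 0 and can be glued. The
  slope of each is at most \<open>2 / a^3\<close> times \<open>3 / 2\<close>; this constant explodes
  as \<open>a\<close> tends to 0.\<close>

lemma osc_val''_lipschitz: "\<bar>osc_val'' a b x - osc_val'' a b y\<bar> \<le> 3 / a ^ 3 * \<bar>x - y\<bar>"
proof -
  define f where "f = (\<lambda>k x :: real. - (2 / (a + b) / k\<^sup>2) * (x * std_normal_density (x / k)))"
  define f' where "f' = (\<lambda>k x :: real. 2 / (a + b) / k\<^sup>2 *
    ((x / k)\<^sup>2 * std_normal_density (x / k) - std_normal_density (x / k)))"
  have lip: "\<bar>f k x - f k y\<bar> \<le> 3 / a ^ 3 * \<bar>x - y\<bar>" if "a \<le> k" for k x y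
  proof -
    have "0 < k" using that a_pos by simp
    then have "(f k has_real_derivative f' k z) (at z)" for z
    proof -
      have "((\<lambda>x. x * std_normal_density (x / k)) has_real_derivative
          1 * std_normal_density (z / k) + - (1 * (z / k\<^sup>2) * std_normal_density (z / k)) * z) (at z)"
        using DERIV_mult[OF DERIV_ident DERIV_scaled_density[of k 1 z]] \<open>0 < k\<close> by simp
      from DERIV_cmult[OF this, of "- (2 / (a + b) / k\<^sup>2)"] show ?thesis
        unfolding f_def f'_def
        by (rule DERIV_cong) (simp add: power2_eq_square algebra_simps)
    qed
    then obtain z where z: "f k x - f k y = (x - y) * f' k z"
      using MVT_both[of y x "f k" "f' k"] by metis
    have "\<bar>(z / k)\<^sup>2 * std_normal_density (z / k) - std_normal_density (z / k)\<bar> \<le> 3 / 2"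
      using std_normal_density_moment_bounds(1,3)[of "z / k"]
        mult_nonneg_nonneg[OF zero_le_power2 normal_density_nonneg, of "z / k" 0 1 "z / k"]
        normal_density_nonneg[of 0 1 "z / k"] by linarith
    moreover have "\<bar>2 / (a + b) / k\<^sup>2\<bar> \<le> 2 / a / a\<^sup>2"
    proof -
      have "2 / (a + b) / k\<^sup>2 \<le> 2 / a / a\<^sup>2"
        using that a_pos b_pos by (intro frac_le power_mono) auto
      then show ?thesis
        using ab_pos by simp
    qed
    ultimately have "\<bar>f' k z\<bar> \<le> 2 / a / a\<^sup>2 * (3 / 2)"
      unfolding f'_def abs_mult using a_pos by (intro mult_mono) auto
    also have "\<dots> = 3 / a ^ 3"
      by (simp add: power2_eq_square power3_eq_cube)
    finally show ?thesis
      unfolding z abs_mult by (metis abs_ge_zero mult.commute mult_left_mono)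
  qed
  have "osc_val'' a b = (\<lambda>x. if x \<le> 0 then f b x else f a x)"
    unfolding osc_val''_def osc_scale_def f_def by auto
  then show ?thesis
    using lipschitz_glue_at_0[of "f b" "3 / a ^ 3" "f a" x y] lip a_le_b
    by (simp add: f_def)
qed

lemma osc_val_taylor:
  "\<bar>osc_val a b (y + w) - osc_val a b y - osc_val' a b y * w - osc_val'' a b y * w\<^sup>2 / 2\<bar>
    \<le> 3 / a ^ 3 * \<bar>w\<bar> ^ 3"
  using a_pos
  by (intro taylor2_lipschitz DERIV_osc_val DERIV_osc_val' osc_val''_lipschitz) auto

text \<open>Dividing by \<open>sqrt (1 + t)\<close> keeps the sign, so both values lie on the same
  piece and \<open>heat_time_expansion\<close> applies to it; the prefactor
  \<open>2 * k / (a + b)\<close> is at most 2, which doubles the error. This is the heat equation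
  with volatility \<open>osc_scale\<close>.\<close>

lemma osc_val_time:
  assumes "0 \<le> t"
  shows "\<bar>osc_val a b (y / sqrt (1 + t)) - osc_val a b y
    - t / 2 * ((osc_scale a b y)\<^sup>2 * osc_val'' a b y)\<bar> \<le> 4 * t\<^sup>2"
proof -
  define k where "k = osc_scale a b y"
  have k: "0 < k" "k \<le> b"
    using osc_scale_bounds unfolding k_def by auto
  have sgn: "y / sqrt (1 + t) \<le> 0 \<longleftrightarrow> y \<le> 0"
    using assms by (auto simp: field_simps)
  have "osc_val a b (y / sqrt (1 + t)) - osc_val a b y
      = 2 * k / (a + b) * (Phi (y / k / sqrt (1 + t)) - Phi (y / k))"
    unfolding osc_val_def sgn k_def osc_scale_def
    by (simp add: right_diff_distrib mult.commute)
  moreover have "t / 2 * (k\<^sup>2 * osc_val'' a b y)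
      = - (2 * k / (a + b) * (t / 2 * (y / k * std_normal_density (y / k))))"
    unfolding osc_val''_def k_def[symmetric] using k by (simp add: power2_eq_square)
  ultimately have "\<bar>osc_val a b (y / sqrt (1 + t)) - osc_val a b y
      - t / 2 * (k\<^sup>2 * osc_val'' a b y)\<bar> = 2 * k / (a + b) *
      \<bar>Phi (y / k / sqrt (1 + t)) - Phi (y / k) + t / 2 * (y / k * std_normal_density (y / k))\<bar>"
    using k ab_pos by (simp only: diff_minus_eq_add flip: distrib_left) (simp add: abs_mult)
  also have "\<dots> \<le> 2 * (2 * t\<^sup>2)"
    using k a_pos b_pos by (intro mult_mono heat_time_expansion assms) (auto simp: field_simps)
  finally show ?thesis
    unfolding k_def by simp
qed

lemma osc_val'_bounds: "0 \<le> osc_val' a b y" "osc_val' a b y \<le> 1 / b"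
proof -
  show "0 \<le> osc_val' a b y"
    unfolding osc_val'_def using ab_pos by simp
  have "osc_val' a b y \<le> 2 / (a + b) * (1 / 2)"
    unfolding osc_val'_def using ab_pos by (intro mult_left_mono std_normal_density_moment_bounds) auto
  also have "\<dots> \<le> 1 / b"
    using a_pos b_pos by (auto simp: field_simps)
  finally show "osc_val' a b y \<le> 1 / b" .
qed

lemma osc_val_mono: "x \<le> y \<Longrightarrow> osc_val a b x \<le> osc_val a b y"
  using DERIV_nonneg_imp_nondecreasing DERIV_osc_val osc_val'_bounds(1) by blast

text \<open>The constant is uniform in \<open>a\<close>, which keeps the later error term
  \<open>gap\<close> free of \<open>a\<close>.\<close>

lemma osc_val_lipschitz: "\<bar>osc_val a b x - osc_val a b y\<bar> \<le> 1 / b * \<bar>x - y\<bar>"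
proof -
  obtain z where z: "osc_val a b x - osc_val a b y = (x - y) * osc_val' a b z"
    using MVT_both[of y x "osc_val a b" "osc_val' a b"] DERIV_osc_val by metis
  have "\<bar>osc_val' a b z\<bar> \<le> 1 / b"
    using osc_val'_bounds[of z] by simp
  then show ?thesis
    unfolding z abs_mult by (metis abs_ge_zero mult.commute mult_left_mono)
qed

lemma osc_val_bounds: "0 \<le> osc_val a b y" "osc_val a b y \<le> 1"
proof -
  note [simp] = std_normal.cdf_nonneg std_normal.cdf_bounded_prob
  show "0 \<le> osc_val a b y"
    unfolding osc_val_def using a_pos a_le_b by auto
  have "Phi (y / b) \<le> 1 / 2" if "y \<le> 0"
    using std_normal.cdf_nondecreasing[of "y / b" 0] that b_pos by (simp add: Phi_0 field_simps)
  then have "2 * b / (a + b) * Phi (y / b) \<le> 2 * b / (a + b) * (1 / 2)" if "y \<le> 0"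
    using that a_pos b_pos by (intro mult_left_mono) auto
  moreover have "2 * b / (a + b) * (1 / 2) \<le> 1"
    using a_pos b_pos by (simp add: field_simps)
  moreover have "2 * a / (a + b) * Phi (y / a) \<le> 2 * a / (a + b) * 1"
    using a_pos b_pos by (intro mult_left_mono) auto
  moreover have "(b - a) / (a + b) + 2 * a / (a + b) * 1 = 1"
    using ab_pos by (simp flip: add_divide_distrib)
  ultimately show "osc_val a b y \<le> 1"
    unfolding osc_val_def by (smt (verit))
qed

lemma osc_val''_sign: "y \<le> 0 \<Longrightarrow> 0 \<le> osc_val'' a b y" "0 \<le> y \<Longrightarrow> osc_val'' a b y \<le> 0"
  unfolding osc_val''_def using ab_pos
  by (auto simp: mult_le_0_iff zero_le_mult_iff divide_le_0_iff zero_le_divide_iff)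

lemma osc_val''_bound: "\<bar>osc_val'' a b y\<bar> \<le> 1 / (a * b)"
proof -
  define k where "k = osc_scale a b y"
  have k: "a \<le> k" "0 < k"
    using osc_scale_bounds unfolding k_def by auto
  have "\<bar>osc_val'' a b y\<bar> = 2 / (a + b) * (1 / k) * (\<bar>y / k\<bar> * std_normal_density (y / k))"
    unfolding osc_val''_def k_def[symmetric] using k ab_pos
    by (simp add: abs_mult power2_eq_square)
  also have "\<dots> \<le> 2 / b * (1 / a) * (1 / 2)"
    using k a_pos b_pos
    by (intro mult_mono frac_le std_normal_density_moment_bounds(2)) auto
  finally show ?thesis by (simp add: mult.commute)
qed

text \<open>Below 0 the value is convex and the scale is the largest volatility, so the product is
  not positive. Above 0 it is concave with scale \<open>a\<close>, and only volatilities in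
  \<open>{l..<a}\<close> can gain. The gain is at most \<open>(a - l) * (a + l) / (a * b)\<close>,
  and \<open>a + l <= 2 * a\<close> cancels the dangerous factor \<open>1 / a\<close>.\<close>

lemma osc_val''_control:
  assumes "l \<le> \<sigma>" "\<sigma> \<le> b" "0 \<le> l" "l \<le> a"
  shows "(\<sigma>\<^sup>2 - (osc_scale a b y)\<^sup>2) * osc_val'' a b y \<le> 2 * (a - l) / b"
proof (cases "y \<le> 0")
  case True
  then have "(\<sigma>\<^sup>2 - (osc_scale a b y)\<^sup>2) * osc_val'' a b y \<le> 0"
    using assms osc_val''_sign[of y]
    by (intro mult_nonpos_nonneg) (auto simp: osc_scale_def intro!: power_mono)
  also have "\<dots> \<le> 2 * (a - l) / b"
    using assms b_pos by auto
  finally show ?thesis .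
next
  case False
  then have y: "osc_scale a b y = a" "osc_val'' a b y \<le> 0"
    using osc_val''_sign[of y] by (auto simp: osc_scale_def)
  have "(\<sigma>\<^sup>2 - a\<^sup>2) * osc_val'' a b y = (a\<^sup>2 - \<sigma>\<^sup>2) * \<bar>osc_val'' a b y\<bar>"
    using y by (simp add: algebra_simps)
  also have "\<dots> \<le> (a\<^sup>2 - l\<^sup>2) * \<bar>osc_val'' a b y\<bar>"
    using assms by (intro mult_right_mono) (auto intro!: power_mono)
  also have "\<dots> \<le> (a\<^sup>2 - l\<^sup>2) * (1 / (a * b))"
    using assms by (intro mult_left_mono osc_val''_bound) (auto intro!: power_mono)
  also have "\<dots> = (a - l) / b * ((a + l) / a)"
    using a_pos b_pos by (simp add: field_simps power2_eq_square)
  also have "\<dots> \<le> (a - l) / b * 2"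
    using assms a_pos b_pos by (intro mult_left_mono) (auto simp: field_simps)
  finally show ?thesis
    using y by (simp add: mult.commute)
qed

end

section \<open>One step of the random walk\<close>

lemma sets_natural_filtration:
  "sets (natural_filtration M X i) =
    sigma_sets (space M) {X j -` B \<inter> space M | j B. j \<in> {1..i} \<and> B \<in> sets borel}"
  unfolding natural_filtration_def by (rule sets_measure_of) auto

lemma space_natural_filtration [simp]: "space (natural_filtration M X i) = space M"
  unfolding natural_filtration_def by (rule space_measure_of) auto

lemma subalgebra_natural_filtration:
  assumes "\<And>j. 1 \<le> j \<Longrightarrow> j \<le> i \<Longrightarrow> X j \<in> borel_measurable M"
  shows "subalgebra M (natural_filtration M X i)"
  unfolding subalgebra_def sets_natural_filtration
  using assms by (auto intro!: sets.sigma_sets_subset measurable_sets)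

lemma natural_filtration_mono:
  assumes "i \<le> j" "Z \<in> borel_measurable (natural_filtration M X i)"
  shows "Z \<in> borel_measurable (natural_filtration M X j)"
proof -
  have "subalgebra (natural_filtration M X j) (natural_filtration M X i)"
    unfolding subalgebra_def sets_natural_filtration using assms(1)
    by (auto intro!: sigma_sets_mono') (metis order_trans)
  then show ?thesis
    using assms(2) measurable_from_subalg by blast
qed

lemma natural_filtration_adapted:
  assumes "1 \<le> j" "j \<le> i"
  shows "X j \<in> borel_measurable (natural_filtration M X i)"
proof (rule measurableI)
  fix B :: "real set" assume "B \<in> sets borel"
  with assms show "X j -` B \<inter> space (natural_filtration M X i) \<in> sets (natural_filtration M X i)"
    unfolding sets_natural_filtration by (auto intro!: sigma_sets.Basic)
qed simp

text \<open>Grouping the independent generators into the index blocks \<open>{1..m}\<close> and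
  \<open>{Suc m}\<close> gives independent sigma-algebras; the first is the filtration at
  \<open>m\<close> and contains the one generated by \<open>Z\<close>.\<close>

lemma (in prob_space) indep_var_natural_filtration:
  assumes indep: "indep_vars (\<lambda>_. borel) X {1..}"
    and Z: "Z \<in> borel_measurable (natural_filtration M X m)"
  shows "indep_var borel Z borel (X (Suc m))"
proof -
  define E where "E = (\<lambda>i. {X i -` A \<inter> space M | A. A \<in> sets (borel :: real measure)})"
  have rv: "X i \<in> borel_measurable M" if "1 \<le> i" for i
    using indep that unfolding indep_vars_def by auto
  have indE: "indep_sets E {1..}"
    using indep unfolding indep_vars_def2 E_def by auto
  define I where "I = case_bool {1..m} {Suc m}"
  have "indep_sets (\<lambda>j. sigma_sets (space M) (\<Union>i\<in>I j. E i)) UNIV"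
  proof (rule indep_sets_collect_sigma)
    show "indep_sets E (\<Union>j\<in>UNIV. I j)"
      by (rule indep_sets_mono_index[OF _ indE]) (auto simp: I_def split: bool.splits)
    show "Int_stable (E i)" for i
      unfolding E_def by (auto simp: Int_stable_def) (metis sets.Int vimage_Int Int_assoc Int_commute Int_left_absorb)
    show "disjoint_family_on I UNIV"
      by (auto simp: disjoint_family_on_def I_def split: bool.splits)
  qed
  moreover have "(\<lambda>j. sigma_sets (space M) (\<Union>i\<in>I j. E i)) =
      case_bool (sets (natural_filtration M X m)) (sigma_sets (space M) (E (Suc m)))"
  proof -
    have "(\<Union>i\<in>{1..m}. E i) = {X j -` B \<inter> space M | j B. j \<in> {1..m} \<and> B \<in> sets borel}"
      unfolding E_def by blast
    then show ?thesis
      unfolding I_def sets_natural_filtration by (auto simp: fun_eq_iff split: bool.splits)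
  qed
  ultimately have "indep_set (sets (natural_filtration M X m)) (sigma_sets (space M) (E (Suc m)))"
    unfolding indep_set_def by simp
  moreover have "sigma_sets (space M) {Z -` A \<inter> space M | A. A \<in> sets borel}
      \<subseteq> sets (natural_filtration M X m)"
    using sets.sigma_sets_subset[of "{Z -` A \<inter> space M | A. A \<in> sets borel}" "natural_filtration M X m"]
      measurable_sets[OF Z] by auto
  ultimately have "indep_set (sigma_sets (space M) {Z -` A \<inter> space M | A. A \<in> sets borel})
      (sigma_sets (space M) (E (Suc m)))"
    unfolding indep_sets2_eq by blast
  moreover have "Z \<in> borel_measurable M"
    using measurable_from_subalg[OF subalgebra_natural_filtration Z] rv by auto
  ultimately show ?thesis
    unfolding indep_var_eq E_def using rv by auto
qed

lemma borel_measurable_osc [measurable]: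
  "osc_scale a b \<in> borel_measurable borel"
  "osc_val a b \<in> borel_measurable borel"
  "osc_val' a b \<in> borel_measurable borel"
  "osc_val'' a b \<in> borel_measurable borel"
proof -
  have [measurable]: "Phi \<in> borel_measurable borel"
    by (intro borel_measurable_continuous_onI continuous_at_imp_continuous_on ballI isCont_Phi)
  show [measurable]: "osc_scale a b \<in> borel_measurable borel"
    unfolding osc_scale_def[abs_def] by measurable
  show "osc_val a b \<in> borel_measurable borel" "osc_val' a b \<in> borel_measurable borel"
    "osc_val'' a b \<in> borel_measurable borel"
    unfolding osc_val_def[abs_def] osc_val'_def[abs_def] osc_val''_def[abs_def] by measurable
qed

lemma (in prob_space) integrable_lower_power:
  fixes X :: "'a \<Rightarrow> real"
  assumes "X \<in> borel_measurable M" "integrable M (\<lambda>\<omega>. \<bar>X \<omega>\<bar> ^ k)" "i \<le> k"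
  shows "integrable M (\<lambda>\<omega>. X \<omega> ^ i)"
proof (rule Bochner_Integration.integrable_bound[where f = "\<lambda>\<omega>. 1 + \<bar>X \<omega>\<bar> ^ k"])
  show "integrable M (\<lambda>\<omega>. 1 + \<bar>X \<omega>\<bar> ^ k)"
    using assms by auto
  have "\<bar>x\<bar> ^ i \<le> 1 + \<bar>x\<bar> ^ k" for x :: real
    using power_increasing[OF assms(3), of "\<bar>x\<bar>"] power_le_one[of "\<bar>x\<bar>" i]
      zero_le_power[of "\<bar>x\<bar>" k] by (cases "\<bar>x\<bar> \<le> 1") linarith+
  then show "AE \<omega> in M. norm (X \<omega> ^ i) \<le> norm (1 + \<bar>X \<omega>\<bar> ^ k)"
    by (intro AE_I2) (simp add: power_abs add_nonneg_nonneg)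
qed (use assms in measurable)

text \<open>The first summand is the third-order Taylor error in space, the second the error of
  \<open>osc_val_time\<close>. Both are uniform over the controls and over all remaining times of at
  least \<delta>.\<close>

definition step_const :: "real \<Rightarrow> real \<Rightarrow> real \<Rightarrow> real \<Rightarrow> real" where
  "step_const a b \<delta> m = 3 / a ^ 3 * (b ^ 3 * m / sqrt \<delta> ^ 3) + 4 / \<delta>\<^sup>2"

text \<open>\<open>F\<close> is the past, \<open>X\<close> the position relative to the barrier,
  \<open>h\<close> the time step and \<open>s\<close> the time left after it. Independence of
  \<open>e\<close> from every \<open>F\<close>-measurable variable replaces conditional expectation:
  the first-order term in \<open>e\<close> averages out, the second-order one becomes \<sigma>
  squared times \<open>osc_val''\<close>, and the passage of time subtracts the same with
  \<open>osc_scale\<close>.\<close>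

lemma (in prob_space) osc_val_step:
  assumes osc: "0 < a" "a \<le> b"
    and F: "subalgebra M F" and X: "X \<in> borel_measurable F" and \<sigma>: "\<sigma> \<in> borel_measurable F"
    and \<sigma>_bounds: "\<And>\<omega>. \<omega> \<in> space M \<Longrightarrow> 0 \<le> \<sigma> \<omega> \<and> \<sigma> \<omega> \<le> b"
    and indep: "\<And>Z. Z \<in> borel_measurable F \<Longrightarrow> indep_var borel Z borel e"
    and e3: "integrable M (\<lambda>\<omega>. \<bar>e \<omega>\<bar> ^ 3)" "expectation (\<lambda>\<omega>. \<bar>e \<omega>\<bar> ^ 3) \<le> m"
    and e1: "expectation e = 0" and e2: "expectation (\<lambda>\<omega>. (e \<omega>)\<^sup>2) = 1"
    and h: "0 < h" "h \<le> 1" and \<delta>: "0 < \<delta>" "\<delta> \<le> s"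
  shows "\<bar>expectation (\<lambda>\<omega>. osc_val a b ((X \<omega> + \<sigma> \<omega> * (sqrt h * e \<omega>)) / sqrt s))
      - expectation (\<lambda>\<omega>. osc_val a b (X \<omega> / sqrt (s + h)))
      - h / (2 * s) * expectation (\<lambda>\<omega>. ((\<sigma> \<omega>)\<^sup>2 - (osc_scale a b (X \<omega> / sqrt s))\<^sup>2)
          * osc_val'' a b (X \<omega> / sqrt s))\<bar> \<le> step_const a b \<delta> m * (h * sqrt h)"
proof -
  interpret osc a b by unfold_locales (use osc in auto)
  note [measurable (raw)] = measurable_from_subalg[OF F]
  have [measurable]: "X \<in> borel_measurable M" "\<sigma> \<in> borel_measurable M"
    using X \<sigma> by measurable
  \<comment> \<open>Independence includes measurability, so a constant \<open>Z\<close>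
    suffices.\<close>
  have em [measurable]: "e \<in> borel_measurable M"
    using indep[of "\<lambda>_. 0"] by (auto simp: indep_var_eq)
  define Y where "Y = (\<lambda>\<omega>. X \<omega> / sqrt s)"
  have Y [measurable]: "Y \<in> borel_measurable F"
    unfolding Y_def using X by measurable
  then have YM [measurable]: "Y \<in> borel_measurable M" by measurable
  define t where "t = h / s"
  have s: "0 < s" and t: "0 \<le> t" "t \<le> h / \<delta>"
    unfolding t_def using h \<delta> by (auto intro!: frac_le)
  define w where "w = (\<lambda>\<omega>. \<sigma> \<omega> * (sqrt h * e \<omega>) / sqrt s)"
  have [measurable]: "w \<in> borel_measurable M" unfolding w_def by measurable
  define P where "P = (\<lambda>\<omega>. osc_val' a b (Y \<omega>) * \<sigma> \<omega>)"
  define Q where "Q = (\<lambda>\<omega>. osc_val'' a b (Y \<omega>) * (\<sigma> \<omega>)\<^sup>2)"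
  define R where "R = (\<lambda>\<omega>. ((\<sigma> \<omega>)\<^sup>2 - (osc_scale a b (Y \<omega>))\<^sup>2) * osc_val'' a b (Y \<omega>))"
  define A where "A = (\<lambda>\<omega>. osc_val a b (Y \<omega> + w \<omega>))"
  define B where "B = (\<lambda>\<omega>. osc_val a b (Y \<omega> / sqrt (1 + t)))"
  have PQ: "P \<in> borel_measurable F" "Q \<in> borel_measurable F"
    unfolding P_def Q_def using Y \<sigma> by measurable
  then have [measurable]: "P \<in> borel_measurable M" "Q \<in> borel_measurable M"
    by measurable
  have [measurable]: "R \<in> borel_measurable M" "A \<in> borel_measurable M" "B \<in> borel_measurable M"
    unfolding R_def A_def B_def by measurable
  have int_e: "integrable M e" "integrable M (\<lambda>\<omega>. (e \<omega>)\<^sup>2)"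
    using integrable_lower_power[OF em e3(1), of 1] integrable_lower_power[OF em e3(1), of 2] by auto
  have int_P: "integrable M P"
  proof (rule integrable_const_bound)
    show "AE \<omega> in M. norm (P \<omega>) \<le> 1 / b * b"
      unfolding P_def real_norm_def abs_mult using \<sigma>_bounds osc_val'_bounds b_pos
      by (intro AE_I2 mult_mono) (auto simp: abs_of_nonneg)
  qed measurable
  have int_Q: "integrable M Q"
  proof (rule integrable_const_bound)
    show "AE \<omega> in M. norm (Q \<omega>) \<le> 1 / (a * b) * b\<^sup>2"
      unfolding Q_def real_norm_def abs_mult using \<sigma>_bounds osc_val''_bound a_pos b_pos
      by (intro AE_I2 mult_mono) (auto intro!: power_mono)
  qed measurable
  have int_R: "integrable M R"
  proof (rule integrable_const_bound)
    have "\<bar>(\<sigma> \<omega>)\<^sup>2 - (osc_scale a b (Y \<omega>))\<^sup>2\<bar> \<le> b\<^sup>2" if "\<omega> \<in> space M" for \<omega>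
      using power_mono[of "\<sigma> \<omega>" b 2] power_mono[of "osc_scale a b (Y \<omega>)" b 2] \<sigma>_bounds[OF that]
        osc_scale_bounds[of "Y \<omega>"] zero_le_power2[of "\<sigma> \<omega>"] zero_le_power2[of "osc_scale a b (Y \<omega>)"]
      by linarith
    then show "AE \<omega> in M. norm (R \<omega>) \<le> b\<^sup>2 * (1 / (a * b))"
      unfolding R_def real_norm_def abs_mult using osc_val''_bound
      by (intro AE_I2 mult_mono) auto
  qed measurable
  have int_A: "integrable M A" and int_B: "integrable M B"
    unfolding A_def B_def
    by (rule integrable_const_bound[where B = 1]; simp add: osc_val_bounds)+
  have PE: "integrable M (\<lambda>\<omega>. P \<omega> * e \<omega>)" "expectation (\<lambda>\<omega>. P \<omega> * e \<omega>) = 0"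
    using indep_var_integrable[OF indep[OF PQ(1)] int_P int_e(1)]
      indep_var_lebesgue_integral[OF indep[OF PQ(1)] int_P int_e(1)] e1 by auto
  \<comment> \<open>Independence passes to the square of \<open>e\<close>, whose mean 1 leaves just
    \<open>expectation Q\<close>.\<close>
  have "indep_var borel ((\<lambda>x. x) \<circ> Q) borel ((\<lambda>x. x\<^sup>2) \<circ> e)"
    by (rule indep_var_compose[OF indep[OF PQ(2)]]) measurable
  then have "indep_var borel Q borel (\<lambda>\<omega>. (e \<omega>)\<^sup>2)"
    by (simp add: comp_def)
  then have QE: "integrable M (\<lambda>\<omega>. Q \<omega> * (e \<omega>)\<^sup>2)" "expectation (\<lambda>\<omega>. Q \<omega> * (e \<omega>)\<^sup>2) = expectation Q"
    using indep_var_integrable[OF _ int_Q int_e(2)]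
      indep_var_lebesgue_integral[OF _ int_Q int_e(2)] e2 by auto
  \<comment> \<open>The subtracted \<open>P\<close> and \<open>Q\<close> terms have mean \<open>0\<close>; pointwise, \<open>D\<close> is the Taylor error in space minus
    the expansion error in time.\<close>
  define D where "D = (\<lambda>\<omega>. A \<omega> - B \<omega> - sqrt h / sqrt s * (P \<omega> * e \<omega>)
    - t / 2 * (Q \<omega> * (e \<omega>)\<^sup>2 - Q \<omega>) - t / 2 * R \<omega>)"
  have int_D: "integrable M D"
    unfolding D_def by (intro Bochner_Integration.integrable_diff integrable_mult_right
        int_A int_B PE QE int_Q int_R)
  have ED: "expectation D = expectation A - expectation B - t / 2 * expectation R"
    unfolding D_def using int_A int_B PE QE int_Q int_R by simp
  have D_bound: "\<bar>D \<omega>\<bar> \<le> 3 / a ^ 3 * (b ^ 3 * (h * sqrt h) / sqrt \<delta> ^ 3) * \<bar>e \<omega>\<bar> ^ 3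
      + 4 / \<delta>\<^sup>2 * (h * sqrt h)" if \<omega>: "\<omega> \<in> space M" for \<omega>
  proof -
    have w2: "(w \<omega>)\<^sup>2 = t * ((\<sigma> \<omega>)\<^sup>2 * (e \<omega>)\<^sup>2)"
      unfolding w_def t_def using h s by (simp add: power_mult_distrib power_divide)
    have w1: "osc_val' a b (Y \<omega>) * w \<omega> = sqrt h / sqrt s * (P \<omega> * e \<omega>)"
      unfolding w_def P_def by simp
    have "D \<omega> = (A \<omega> - osc_val a b (Y \<omega>) - osc_val' a b (Y \<omega>) * w \<omega>
          - osc_val'' a b (Y \<omega>) * (w \<omega>)\<^sup>2 / 2)
        - (B \<omega> - osc_val a b (Y \<omega>)
          - t / 2 * ((osc_scale a b (Y \<omega>))\<^sup>2 * osc_val'' a b (Y \<omega>)))"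
      unfolding w1 w2 D_def Q_def R_def by (simp add: algebra_simps)
    then have "\<bar>D \<omega>\<bar> \<le> 3 / a ^ 3 * \<bar>w \<omega>\<bar> ^ 3 + 4 * t\<^sup>2"
      using osc_val_taylor[of "Y \<omega>" "w \<omega>"] osc_val_time[OF t(1), of "Y \<omega>"]
      unfolding A_def B_def by linarith
    also have "\<dots> \<le> 3 / a ^ 3 * (b ^ 3 * (h * sqrt h) / sqrt \<delta> ^ 3 * \<bar>e \<omega>\<bar> ^ 3)
        + 4 * (h * sqrt h / \<delta>\<^sup>2)"
    proof (intro add_mono mult_left_mono)
      show "\<bar>w \<omega>\<bar> ^ 3 \<le> b ^ 3 * (h * sqrt h) / sqrt \<delta> ^ 3 * \<bar>e \<omega>\<bar> ^ 3"
      proof -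
      have h3: "h * sqrt h = sqrt h ^ 3"
        using h by (simp add: power3_eq_cube)
      have "\<bar>w \<omega>\<bar> = \<sigma> \<omega> * (sqrt h * \<bar>e \<omega>\<bar>) / sqrt s"
        unfolding w_def using \<sigma>_bounds[OF \<omega>] h s by (simp add: abs_mult)
      also have "\<dots> \<le> b * (sqrt h * \<bar>e \<omega>\<bar>) / sqrt \<delta>"
        using \<sigma>_bounds[OF \<omega>] h \<delta> b_pos by (intro frac_le mult_mono) auto
      finally have "\<bar>w \<omega>\<bar> ^ 3 \<le> (b * (sqrt h * \<bar>e \<omega>\<bar>) / sqrt \<delta>) ^ 3"
        by (intro power_mono) auto
      then show ?thesis
        unfolding h3 by (simp add: power_mult_distrib power_divide mult.assoc)
    qed
      show "t\<^sup>2 \<le> h * sqrt h / \<delta>\<^sup>2"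
    proof -
      have "t\<^sup>2 \<le> (h / \<delta>)\<^sup>2"
        using t by (intro power_mono) auto
      \<comment> \<open>As \<open>h <= 1\<close>, the time error of order \<open>h^2\<close> can be
        weakened to the order of the space error.\<close>
      moreover have "h\<^sup>2 \<le> h * sqrt h"
      proof -
        have "h \<le> sqrt h"
          using h by (intro real_le_rsqrt) (simp add: power2_eq_square mult_left_le)
        then show ?thesis
          using h by (simp add: power2_eq_square)
      qed
      ultimately show ?thesis
        using \<delta> by (smt (verit) divide_right_mono power_divide zero_le_power2)
    qed
    qed (use a_pos in auto)
    finally show ?thesis
      by (simp add: mult.assoc)
  qed
  have "\<bar>expectation D\<bar> \<le> expectation (\<lambda>\<omega>. \<bar>D \<omega>\<bar>)"
    using integral_norm_bound[of M D] by simp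
  also have "\<dots> \<le> expectation (\<lambda>\<omega>. 3 / a ^ 3 * (b ^ 3 * (h * sqrt h) / sqrt \<delta> ^ 3) * \<bar>e \<omega>\<bar> ^ 3
      + 4 / \<delta>\<^sup>2 * (h * sqrt h))"
    using int_D e3 D_bound by (intro integral_mono) auto
  also have "\<dots> = 3 / a ^ 3 * (b ^ 3 * (h * sqrt h) / sqrt \<delta> ^ 3) * expectation (\<lambda>\<omega>. \<bar>e \<omega>\<bar> ^ 3)
      + 4 / \<delta>\<^sup>2 * (h * sqrt h)"
    using e3 by (simp add: prob_space)
  also have "\<dots> \<le> 3 / a ^ 3 * (b ^ 3 * (h * sqrt h) / sqrt \<delta> ^ 3) * m + 4 / \<delta>\<^sup>2 * (h * sqrt h)"
    using a_pos b_pos h \<delta> e3 by (intro add_right_mono mult_left_mono) auto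
  also have "\<dots> = step_const a b \<delta> m * (h * sqrt h)"
    unfolding step_const_def by (simp add: algebra_simps)
  finally have "\<bar>expectation A - expectation B - t / 2 * expectation R\<bar> \<le> step_const a b \<delta> m * (h * sqrt h)"
    unfolding ED .
  moreover have "A = (\<lambda>\<omega>. osc_val a b ((X \<omega> + \<sigma> \<omega> * (sqrt h * e \<omega>)) / sqrt s))"
    unfolding A_def Y_def w_def by (simp add: add_divide_distrib)
  moreover have "B = (\<lambda>\<omega>. osc_val a b (X \<omega> / sqrt (s + h)))"
  proof -
    have "s + h = s * (1 + t)"
      unfolding t_def using s by (simp add: field_simps)
    then show ?thesis
      unfolding B_def Y_def by (simp add: real_sqrt_mult)
  qed
  moreover have "t / 2 = h / (2 * s)"
    unfolding t_def by simp
  ultimately show ?thesis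
    unfolding R_def Y_def by simp
qed

section \<open>Convergence of the optimal probabilities\<close>

context osc
begin

text \<open>The prefactors are at most 2, and above 0 the scale \<open>a <= b\<close> only makes the
  tail lighter, so one bound free of \<open>a\<close> serves both sides.\<close>

lemma osc_val_tails:
  assumes "0 \<le> y"
  shows "osc_val a b (- y) \<le> 2 * Phi (- y / b)" "1 - osc_val a b y \<le> 2 * Phi (- y / b)"
proof -
  note nonneg = std_normal.cdf_nonneg
  have "2 * b / (a + b) * Phi (- y / b) \<le> 2 * Phi (- y / b)"
    using a_pos b_pos by (intro mult_right_mono nonneg) (auto simp: field_simps)
  then show *: "osc_val a b (- y) \<le> 2 * Phi (- y / b)"
    unfolding osc_val_def using assms by auto
  show "1 - osc_val a b y \<le> 2 * Phi (- y / b)"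
  proof (cases "y = 0")
    case True
    then show ?thesis
      using osc_val_bounds(1)[of 0] by (simp add: Phi_0)
  next
    case False
    have "1 - osc_val a b y = 2 * a / (a + b) * Phi (- (y / a))"
    proof -
      have "1 - (b - a) / (a + b) = 2 * a / (a + b)"
        using ab_pos by (simp add: field_simps)
      then show ?thesis
        unfolding osc_val_def Phi_minus using False assms by (simp add: algebra_simps)
    qed
    also have "\<dots> \<le> 2 * Phi (- (y / b))"
      using a_pos b_pos a_le_b assms
      by (intro mult_mono nonneg std_normal.cdf_nondecreasing) (auto simp: field_simps mult_right_mono)
    finally show ?thesis by simp
  qed
qed

text \<open>The target probability is \<open>osc_val a b (- c)\<close>, so the Lipschitz bound
  measures the cost of the extra time \<delta> and of a barrier shift \<eta> of either sign.\<close>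

lemma osc_val_perturbed:
  assumes "0 \<le> c" "0 \<le> \<delta>" "\<bar>\<eta>\<bar> \<le> r"
  shows "\<bar>osc_val a b ((\<eta> - c) / sqrt (1 + \<delta>)) - 2 * b / (a + b) * Phi (- c / b)\<bar>
    \<le> (r + c * (1 - 1 / sqrt (1 + \<delta>))) / b"
proof -
  have "2 * b / (a + b) * Phi (- c / b) = osc_val a b (- c)"
    unfolding osc_val_def using assms by simp
  then have "\<bar>osc_val a b ((\<eta> - c) / sqrt (1 + \<delta>)) - 2 * b / (a + b) * Phi (- c / b)\<bar>
      \<le> 1 / b * \<bar>(\<eta> - c) / sqrt (1 + \<delta>) - - c\<bar>"
    by (simp only: osc_val_lipschitz)
  also have "\<bar>(\<eta> - c) / sqrt (1 + \<delta>) - - c\<bar> \<le> r + c * (1 - 1 / sqrt (1 + \<delta>))"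
  proof -
    have s: "1 \<le> sqrt (1 + \<delta>)"
      using assms by simp
    have "\<bar>\<eta> / sqrt (1 + \<delta>)\<bar> \<le> r / 1"
      unfolding abs_divide using s assms by (intro frac_le) auto
    moreover have "0 \<le> c * (1 - 1 / sqrt (1 + \<delta>))"
      using s assms by (intro mult_nonneg_nonneg) (auto simp: field_simps)
    moreover have "(\<eta> - c) / sqrt (1 + \<delta>) - - c = \<eta> / sqrt (1 + \<delta>) + c * (1 - 1 / sqrt (1 + \<delta>))"
      by (simp add: diff_divide_distrib algebra_simps)
    ultimately show ?thesis by linarith
  qed
  finally show ?thesis
    using b_pos by (simp add: divide_right_mono)
qed

end

lemma predictable_seqs_bounds:
  assumes "\<sigma> \<in> predictable_seqs M X l u" "1 \<le> i" "\<omega> \<in> space M"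
  shows "\<sigma> i \<omega> \<in> {l..u}"
  using assms unfolding predictable_seqs_def by blast

section \<open>The controlled walk and its expected value\<close>

locale iid_noise = prob_space M for M :: "'a measure" +
  fixes e :: "nat \<Rightarrow> 'a \<Rightarrow> real" and m :: real
  assumes indep: "indep_vars (\<lambda>_. borel) e {1..}"
    and mean: "1 \<le> i \<Longrightarrow> expectation (e i) = 0"
    and second_moment: "1 \<le> i \<Longrightarrow> expectation (\<lambda>\<omega>. (e i \<omega>)\<^sup>2) = 1"
    and third_integrable: "1 \<le> i \<Longrightarrow> integrable M (\<lambda>\<omega>. \<bar>e i \<omega>\<bar> ^ 3)"
    and third_moment: "1 \<le> i \<Longrightarrow> expectation (\<lambda>\<omega>. \<bar>e i \<omega>\<bar> ^ 3) \<le> m"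
begin

lemma noise_measurable: "1 \<le> i \<Longrightarrow> e i \<in> borel_measurable M"
  using indep unfolding indep_vars_def by auto

lemma filtration_subalgebra: "subalgebra M (natural_filtration M e k)"
  by (intro subalgebra_natural_filtration noise_measurable)

definition psum :: "(nat \<Rightarrow> 'a \<Rightarrow> real) \<Rightarrow> nat \<Rightarrow> 'a \<Rightarrow> real" where
  "psum \<sigma> k \<omega> = (\<Sum>i=1..k. \<sigma> i \<omega> * e i \<omega>)"

lemma psum_Suc: "psum \<sigma> (Suc k) \<omega> = psum \<sigma> k \<omega> + \<sigma> (Suc k) \<omega> * e (Suc k) \<omega>"
  unfolding psum_def by simp

lemma psum_adapted:
  assumes "\<sigma> \<in> predictable_seqs M e l u"
  shows "psum \<sigma> k \<in> borel_measurable (natural_filtration M e k)"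
  unfolding psum_def[abs_def]
proof (intro borel_measurable_sum borel_measurable_times)
  fix i assume i: "i \<in> {1..k}"
  then have "\<sigma> i \<in> borel_measurable (natural_filtration M e (i - 1))"
    using assms unfolding predictable_seqs_def by auto
  then show "\<sigma> i \<in> borel_measurable (natural_filtration M e k)"
    by (rule natural_filtration_mono[rotated]) (use i in auto)
  show "e i \<in> borel_measurable (natural_filtration M e k)"
    using i by (intro natural_filtration_adapted) auto
qed

lemma psum_measurable:
  assumes "\<sigma> \<in> predictable_seqs M e l u"
  shows "psum \<sigma> k \<in> borel_measurable M"
  using measurable_from_subalg[OF filtration_subalgebra psum_adapted[OF assms]] .

text \<open>The mean of \<open>U(s, x)\<close> after \<open>k\<close> steps, with
  \<open>s = \<delta> + 1 - k / n\<close> and barrier \<open>c\<close>. The horizon is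
  \<open>1 + \<delta>\<close>, so time \<delta> is still left after step \<open>n\<close>.\<close>

definition value_at :: "real \<Rightarrow> real \<Rightarrow> (nat \<Rightarrow> 'a \<Rightarrow> real) \<Rightarrow> nat \<Rightarrow> real \<Rightarrow> real \<Rightarrow> nat \<Rightarrow> real" where
  "value_at a b \<sigma> n c \<delta> k = expectation (\<lambda>\<omega>. osc_val a b
     ((psum \<sigma> k \<omega> / sqrt n - c) / sqrt (\<delta> + 1 - real k / real n)))"

text \<open>As in \<open>osc_val_step\<close>, the position is taken before the step but the
  remaining time after it.\<close>

definition drift_at :: "real \<Rightarrow> real \<Rightarrow> (nat \<Rightarrow> 'a \<Rightarrow> real) \<Rightarrow> nat \<Rightarrow> real \<Rightarrow> real \<Rightarrow> nat \<Rightarrow> 'a \<Rightarrow> real" where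
  "drift_at a b \<sigma> n c \<delta> k \<omega> =
     (let y = (psum \<sigma> k \<omega> / sqrt n - c) / sqrt (\<delta> + 1 - real (Suc k) / real n)
      in ((\<sigma> (Suc k) \<omega>)\<^sup>2 - (osc_scale a b y)\<^sup>2) * osc_val'' a b y)"

lemma value_at_step:
  assumes osc: "0 < a" "a \<le> b" and l: "0 \<le> l" and \<sigma>: "\<sigma> \<in> predictable_seqs M e l b"
    and k: "k < n" and \<delta>: "0 < \<delta>"
  shows "\<bar>value_at a b \<sigma> n c \<delta> (Suc k) - value_at a b \<sigma> n c \<delta> k
    - 1 / (2 * n * (\<delta> + 1 - real (Suc k) / real n)) * expectation (drift_at a b \<sigma> n c \<delta> k)\<bar>
    \<le> step_const a b \<delta> m * (1 / n * sqrt (1 / n))"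
proof -
  define h where "h = 1 / real n"
  \<comment> \<open>The time left after the step: at least \<delta>, and \<open>s + h\<close> is the
    time left before it.\<close>
  define s where "s = \<delta> + 1 - real (Suc k) / real n"
  have h: "0 < h" "h \<le> 1" and s: "\<delta> \<le> s" "s + h = \<delta> + 1 - real k / real n"
    unfolding h_def s_def using k by (auto simp: field_simps)
  let ?X = "\<lambda>\<omega>. psum \<sigma> k \<omega> / sqrt n - c"
  let ?F = "natural_filtration M e k"
  have step: "\<bar>expectation (\<lambda>\<omega>. osc_val a b ((?X \<omega> + \<sigma> (Suc k) \<omega> * (sqrt h * e (Suc k) \<omega>)) / sqrt s))
      - expectation (\<lambda>\<omega>. osc_val a b (?X \<omega> / sqrt (s + h)))
      - h / (2 * s) * expectation (\<lambda>\<omega>. ((\<sigma> (Suc k) \<omega>)\<^sup>2 - (osc_scale a b (?X \<omega> / sqrt s))\<^sup>2)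
          * osc_val'' a b (?X \<omega> / sqrt s))\<bar> \<le> step_const a b \<delta> m * (h * sqrt h)"
  proof (rule osc_val_step[where F = ?F])
    show "?X \<in> borel_measurable ?F"
      using psum_adapted[OF \<sigma>] by measurable
    have "\<sigma> (Suc k) \<in> borel_measurable (natural_filtration M e (Suc k - 1))"
      using \<sigma> unfolding predictable_seqs_def by (auto simp del: diff_Suc_1)
    then show "\<sigma> (Suc k) \<in> borel_measurable ?F" by simp
    show "0 \<le> \<sigma> (Suc k) \<omega> \<and> \<sigma> (Suc k) \<omega> \<le> b" if "\<omega> \<in> space M" for \<omega>
      using predictable_seqs_bounds[OF \<sigma> _ that, of "Suc k"] l by auto
  qed (use osc h \<delta> s mean second_moment third_integrable third_moment filtration_subalgebra
        indep_var_natural_filtration[OF indep] in auto)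
  have X_Suc: "?X \<omega> + \<sigma> (Suc k) \<omega> * (sqrt h * e (Suc k) \<omega>) = psum \<sigma> (Suc k) \<omega> / sqrt n - c" for \<omega>
    unfolding psum_Suc h_def by (simp add: add_divide_distrib real_sqrt_divide)
  have "1 / (2 * real n * s) = h / (2 * s)"
    unfolding h_def by simp
  then show ?thesis
    using step unfolding value_at_def drift_at_def Let_def s(2) s_def[symmetric] X_Suc
      h_def[symmetric] by (simp only: of_nat_mult of_nat_numeral)
qed

text \<open>Summation of \<open>value_at_step\<close>: \<open>osc_val''_control\<close> bounds the
  drift for every control, and the remaining time is at least \<delta>.\<close>

lemma value_at_upper:
  assumes osc: "0 < a" "a \<le> b" and l: "0 \<le> l" "l \<le> a" and \<sigma>: "\<sigma> \<in> predictable_seqs M e l b"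
    and n: "0 < n" and \<delta>: "0 < \<delta>" and k: "k \<le> n"
  shows "value_at a b \<sigma> n c \<delta> k \<le> value_at a b \<sigma> n c \<delta> 0
    + k * (1 / n * ((a - l) / (\<delta> * b) + step_const a b \<delta> m * sqrt (1 / n)))"
  using k
proof (induction k)
  case (Suc k)
  interpret osc a b by unfold_locales (use osc in auto)
  define s where "s = \<delta> + 1 - real (Suc k) / real n"
  have s: "\<delta> \<le> s"
    unfolding s_def using Suc.prems n by (simp add: field_simps)
  have D: "drift_at a b \<sigma> n c \<delta> k \<omega> \<le> 2 * (a - l) / b" if "\<omega> \<in> space M" for \<omega>
    unfolding drift_at_def Let_def using predictable_seqs_bounds[OF \<sigma> _ that, of "Suc k"] l
    by (intro osc_val''_control) auto
  have "expectation (drift_at a b \<sigma> n c \<delta> k) \<le> 2 * (a - l) / b"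
  proof (cases "integrable M (drift_at a b \<sigma> n c \<delta> k)")
    case True
    then show ?thesis
      using integral_mono[OF True, of "\<lambda>_. 2 * (a - l) / b"] D by (simp add: prob_space)
  next
    \<comment> \<open>The integral is then 0 by convention, below the nonnegative bound.\<close>
    case False
    then show ?thesis
      using l b_pos by (simp add: not_integrable_integral_eq)
  qed
  then have "1 / (2 * n * s) * expectation (drift_at a b \<sigma> n c \<delta> k) \<le> 1 / (2 * n * s) * (2 * (a - l) / b)"
    using s \<delta> by (intro mult_left_mono) auto
  also have "\<dots> = 1 / n * ((a - l) / (s * b))"
  proof -
    have "1 / (2 * x * s) * (2 * d / b) = 1 / x * (d / (s * b))" for x d
      by simp
    then show ?thesis by (simp only: of_nat_mult of_nat_numeral)
  qed
  also have "\<dots> \<le> 1 / n * ((a - l) / (\<delta> * b))"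
    using s \<delta> l b_pos by (intro mult_left_mono frac_le mult_right_mono) auto
  finally have "value_at a b \<sigma> n c \<delta> (Suc k) \<le> value_at a b \<sigma> n c \<delta> k
      + 1 / n * ((a - l) / (\<delta> * b) + step_const a b \<delta> m * sqrt (1 / n))"
    using value_at_step[OF osc l(1) \<sigma> _ \<delta>, of k n c] Suc.prems
    unfolding s_def[symmetric] abs_le_iff by (simp add: distrib_left mult.left_commute)
  moreover have "real (Suc k) * d = real k * d + d" for d
    by (simp add: distrib_right)
  moreover have "value_at a b \<sigma> n c \<delta> k \<le> value_at a b \<sigma> n c \<delta> 0
      + k * (1 / n * ((a - l) / (\<delta> * b) + step_const a b \<delta> m * sqrt (1 / n)))"
    using Suc.prems by (intro Suc.IH) simp
  ultimately show ?case
    by (simp only:)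
qed simp

text \<open>Dividing by the square root of the remaining time keeps the sign, so switching at the
  unscaled barrier matches \<open>osc_scale\<close> exactly and the drift vanishes
  identically.\<close>

lemma value_at_lower:
  assumes osc: "0 < a" "a \<le> b" and \<sigma>: "\<sigma> \<in> predictable_seqs M e 0 b"
    and n: "0 < n" and \<delta>: "0 < \<delta>" and k: "k \<le> n"
    and opt: "\<And>k \<omega>. k < n \<Longrightarrow> \<sigma> (Suc k) \<omega> = osc_scale a b (psum \<sigma> k \<omega> / sqrt n - c)"
  shows "value_at a b \<sigma> n c \<delta> k \<ge> value_at a b \<sigma> n c \<delta> 0
    - k * (1 / n * (step_const a b \<delta> m * sqrt (1 / n)))"
  using k
proof (induction k)
  case (Suc k)
  define s where "s = \<delta> + 1 - real (Suc k) / real n"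
  have s: "0 < s"
  proof -
    have "real (Suc k) / real n \<le> 1"
      using Suc.prems n by (simp add: field_simps)
    then show ?thesis
      unfolding s_def using \<delta> by simp
  qed
  have "drift_at a b \<sigma> n c \<delta> k = (\<lambda>_. 0)"
    unfolding drift_at_def Let_def s_def[symmetric] using opt[of k] Suc.prems s
    by (auto simp: fun_eq_iff osc_scale_def divide_le_0_iff)
  then have "value_at a b \<sigma> n c \<delta> (Suc k) \<ge> value_at a b \<sigma> n c \<delta> k
      - 1 / n * (step_const a b \<delta> m * sqrt (1 / n))"
    using value_at_step[OF osc _ \<sigma> _ \<delta>, of k n c] Suc.prems
    unfolding abs_le_iff by (simp add: mult.left_commute)
  moreover have "real (Suc k) * (1 / n * (step_const a b \<delta> m * sqrt (1 / n)))
      = real k * (1 / n * (step_const a b \<delta> m * sqrt (1 / n)))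
        + 1 / n * (step_const a b \<delta> m * sqrt (1 / n))"
    by (simp add: distrib_right add_divide_distrib)
  ultimately show ?case
    using Suc.IH Suc.prems by linarith
qed simp

lemma value_at_0: "value_at a b \<sigma> n c \<delta> 0 = osc_val a b (- c / sqrt (1 + \<delta>))"
  unfolding value_at_def psum_def by (simp add: prob_space add.commute)

text \<open>The control below switches at the barrier, using the walk it has generated itself; hence the
  walk is defined first and the volatility \<open>opt_vol\<close> is read off from it.\<close>

primrec opt_walk :: "real \<Rightarrow> real \<Rightarrow> nat \<Rightarrow> real \<Rightarrow> nat \<Rightarrow> 'a \<Rightarrow> real" where
  "opt_walk a b n c 0 \<omega> = 0"
| "opt_walk a b n c (Suc k) \<omega> = opt_walk a b n c k \<omega>
     + osc_scale a b (opt_walk a b n c k \<omega> / sqrt n - c) * e (Suc k) \<omega>"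

definition opt_vol :: "real \<Rightarrow> real \<Rightarrow> nat \<Rightarrow> real \<Rightarrow> nat \<Rightarrow> 'a \<Rightarrow> real" where
  "opt_vol a b n c i \<omega> = osc_scale a b (opt_walk a b n c (i - 1) \<omega> / sqrt n - c)"

lemma psum_opt_vol: "psum (opt_vol a b n c) k \<omega> = opt_walk a b n c k \<omega>"
  by (induction k) (simp_all add: psum_Suc opt_vol_def, simp add: psum_def)

lemma opt_walk_adapted: "opt_walk a b n c k \<in> borel_measurable (natural_filtration M e k)"
proof (induction k)
  case (Suc k)
  have [measurable]: "opt_walk a b n c k \<in> borel_measurable (natural_filtration M e (Suc k))"
    "e (Suc k) \<in> borel_measurable (natural_filtration M e (Suc k))"
    by (auto intro!: natural_filtration_mono[OF _ Suc] natural_filtration_adapted)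
  show ?case
    by (simp del: One_nat_def) measurable
qed simp

lemma opt_vol_predictable:
  assumes "l \<le> a" "a \<le> b"
  shows "opt_vol a b n c \<in> predictable_seqs M e l b"
  unfolding predictable_seqs_def
proof (intro CollectI allI impI conjI ballI)
  fix i :: nat
  have [measurable]: "opt_walk a b n c (i - 1) \<in> borel_measurable (natural_filtration M e (i - 1))"
    by (rule opt_walk_adapted)
  show "opt_vol a b n c i \<in> borel_measurable (natural_filtration M e (i - 1))"
    unfolding opt_vol_def[abs_def] by measurable
  show "opt_vol a b n c i \<omega> \<in> {l..b}" for \<omega>
    using assms by (auto simp: opt_vol_def osc_scale_def)
qed

section \<open>From expected values to probabilities\<close>

lemma scaled_mean_eq_psum:
  assumes "0 < n"
  shows "sqrt n * sample_mean (\<lambda>i \<omega>. \<sigma> i \<omega> * e i \<omega>) n \<omega> = psum \<sigma> n \<omega> / sqrt n"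
  unfolding sample_mean_def psum_def using assms
  by (simp add: field_simps)

lemma value_at_n:
  assumes "0 < n"
  shows "value_at a b \<sigma> n c \<delta> n = expectation (\<lambda>\<omega>. osc_val a b ((psum \<sigma> n \<omega> / sqrt n - c) / sqrt \<delta>))"
  unfolding value_at_def using assms by simp

lemma integrable_osc_val:
  assumes "0 < a" "a \<le> b" "\<sigma> \<in> predictable_seqs M e l u"
  shows "integrable M (\<lambda>\<omega>. osc_val a b ((psum \<sigma> n \<omega> / sqrt n - c) / d))"
proof (rule integrable_const_bound)
  interpret osc a b by unfold_locales (use assms in auto)
  show "AE \<omega> in M. norm (osc_val a b ((psum \<sigma> n \<omega> / sqrt n - c) / d)) \<le> 1"
    by (simp add: osc_val_bounds)
  show "(\<lambda>\<omega>. osc_val a b ((psum \<sigma> n \<omega> / sqrt n - c) / d)) \<in> borel_measurable M"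
    using psum_measurable[OF assms(3)] by measurable
qed

text \<open>The errors not depending on \<open>n\<close>: the perturbed starting value of
  \<open>osc_val_perturbed\<close> plus the tail of \<open>osc_val_tails\<close> at distance
  \<open>\<eta> / sqrt \<delta>\<close>.\<close>

definition gap :: "real \<Rightarrow> real \<Rightarrow> real \<Rightarrow> real \<Rightarrow> real" where
  "gap b c \<delta> \<eta> = (\<eta> + c * (1 - 1 / sqrt (1 + \<delta>))) / b + 2 * Phi (- (\<eta> / sqrt \<delta>) / b)"

text \<open>With the barrier lowered to \<open>c - \<eta>\<close>, the final argument of
  \<open>osc_val\<close> exceeds \<open>\<eta> / sqrt \<delta>\<close> on the event. Hence the
  indicator is at most the final value plus a small tail.\<close>

lemma prob_upper:
  assumes osc: "0 < a" "a \<le> b" and l: "0 \<le> l" "l \<le> a" and \<sigma>: "\<sigma> \<in> predictable_seqs M e l b"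
    and n: "0 < n" and \<delta>: "0 < \<delta>" and c: "0 \<le> c" and \<eta>: "0 \<le> \<eta>"
  shows "prob {\<omega> \<in> space M. sqrt n * sample_mean (\<lambda>i \<omega>. \<sigma> i \<omega> * e i \<omega>) n \<omega> > c}
    \<le> 2 * b / (a + b) * Phi (- c / b) + gap b c \<delta> \<eta> + (a - l) / (\<delta> * b)
      + step_const a b \<delta> m * sqrt (1 / n)"
proof -
  interpret osc a b by unfold_locales (use osc in auto)
  have [measurable]: "psum \<sigma> n \<in> borel_measurable M"
    by (rule psum_measurable[OF \<sigma>])
  define A where "A = {\<omega> \<in> space M. psum \<sigma> n \<omega> / sqrt n > c}"
  have "A \<in> sets M" unfolding A_def by measurable
  then have int_A: "integrable M (indicator A :: 'a \<Rightarrow> real)"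
    by (simp add: less_top[symmetric])
  let ?V = "\<lambda>\<omega>. osc_val a b ((psum \<sigma> n \<omega> / sqrt n - (c - \<eta>)) / sqrt \<delta>)"
  have ind: "indicator A \<omega> \<le> ?V \<omega> + (1 - osc_val a b (\<eta> / sqrt \<delta>))" for \<omega>
  proof (cases "\<omega> \<in> A")
    case True
    then have "osc_val a b (\<eta> / sqrt \<delta>) \<le> ?V \<omega>"
      using \<delta> by (intro osc_val_mono divide_right_mono) (auto simp: A_def)
    with True show ?thesis by simp
  next
    case False
    then show ?thesis
      using osc_val_bounds(1)[of "(psum \<sigma> n \<omega> / sqrt n - (c - \<eta>)) / sqrt \<delta>"]
        osc_val_bounds(2)[of "\<eta> / sqrt \<delta>"] by simp
  qed
  have "prob A = expectation (indicator A)"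
    using \<open>A \<in> sets M\<close> by simp
  also have "\<dots> \<le> expectation (\<lambda>\<omega>. ?V \<omega> + (1 - osc_val a b (\<eta> / sqrt \<delta>)))"
    using integrable_osc_val[OF osc \<sigma>] ind int_A
    by (intro integral_mono Bochner_Integration.integrable_add) auto
  also have "\<dots> = value_at a b \<sigma> n (c - \<eta>) \<delta> n + (1 - osc_val a b (\<eta> / sqrt \<delta>))"
    unfolding value_at_n[OF n] using integrable_osc_val[OF osc \<sigma>] by (simp add: prob_space)
  finally have "prob A \<le> value_at a b \<sigma> n (c - \<eta>) \<delta> n + (1 - osc_val a b (\<eta> / sqrt \<delta>))" .
  moreover have "value_at a b \<sigma> n (c - \<eta>) \<delta> n \<le> osc_val a b ((\<eta> - c) / sqrt (1 + \<delta>))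
      + ((a - l) / (\<delta> * b) + step_const a b \<delta> m * sqrt (1 / n))"
    using value_at_upper[OF osc l \<sigma> n \<delta> order_refl, of "c - \<eta>"] n
    unfolding value_at_0 by simp
  moreover have "1 - osc_val a b (\<eta> / sqrt \<delta>) \<le> 2 * Phi (- (\<eta> / sqrt \<delta>) / b)"
    using \<delta> \<eta> by (intro osc_val_tails) auto
  moreover have "osc_val a b ((\<eta> - c) / sqrt (1 + \<delta>)) \<le> 2 * b / (a + b) * Phi (- c / b)
      + (\<eta> + c * (1 - 1 / sqrt (1 + \<delta>))) / b"
    using osc_val_perturbed[OF c, of \<delta> \<eta> \<eta>] \<delta> \<eta> by (simp add: abs_le_iff)
  ultimately have "prob A \<le> 2 * b / (a + b) * Phi (- c / b) + gap b c \<delta> \<eta> + (a - l) / (\<delta> * b)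
      + step_const a b \<delta> m * sqrt (1 / n)"
    unfolding gap_def by linarith
  then show ?thesis
    unfolding A_def scaled_mean_eq_psum[OF n] .
qed

text \<open>The mirror image of \<open>prob_upper\<close>: the barrier is raised to
  \<open>c + \<eta>\<close>, the control switches there, and off the event the final value is at
  most a small tail.\<close>

lemma prob_lower:
  assumes osc: "0 < a" "a \<le> b" and l: "l \<le> a"
    and n: "0 < n" and \<delta>: "0 < \<delta>" and c: "0 \<le> c" and \<eta>: "0 \<le> \<eta>"
  shows "\<exists>\<sigma>\<in>predictable_seqs M e l b.
    prob {\<omega> \<in> space M. sqrt n * sample_mean (\<lambda>i \<omega>. \<sigma> i \<omega> * e i \<omega>) n \<omega> > c}
    \<ge> 2 * b / (a + b) * Phi (- c / b) - gap b c \<delta> \<eta> - step_const a b \<delta> m * sqrt (1 / n)"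
proof
  interpret osc a b by unfold_locales (use osc in auto)
  define \<sigma> where "\<sigma> = opt_vol a b n (c + \<eta>)"
  show "\<sigma> \<in> predictable_seqs M e l b"
    unfolding \<sigma>_def by (intro opt_vol_predictable l osc)
  have \<sigma>: "\<sigma> \<in> predictable_seqs M e 0 b"
    unfolding \<sigma>_def by (intro opt_vol_predictable) (use osc in auto)
  have opt: "\<sigma> (Suc k) \<omega> = osc_scale a b (psum \<sigma> k \<omega> / sqrt n - (c + \<eta>))" for k \<omega>
    unfolding \<sigma>_def psum_opt_vol by (simp add: opt_vol_def)
  have [measurable]: "psum \<sigma> n \<in> borel_measurable M"
    by (rule psum_measurable[OF \<sigma>])
  define A where "A = {\<omega> \<in> space M. psum \<sigma> n \<omega> / sqrt n > c}"
  have "A \<in> sets M" unfolding A_def by measurable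
  then have int_A: "integrable M (indicator A :: 'a \<Rightarrow> real)"
    by (simp add: less_top[symmetric])
  let ?V = "\<lambda>\<omega>. osc_val a b ((psum \<sigma> n \<omega> / sqrt n - (c + \<eta>)) / sqrt \<delta>)"
  have ind: "?V \<omega> - osc_val a b (- (\<eta> / sqrt \<delta>)) \<le> indicator A \<omega>" if "\<omega> \<in> space M" for \<omega>
  proof (cases "\<omega> \<in> A")
    case False
    then have "?V \<omega> \<le> osc_val a b ((- \<eta>) / sqrt \<delta>)"
      using \<delta> that by (intro osc_val_mono divide_right_mono) (auto simp: A_def)
    with False show ?thesis by simp
  next
    case True
    then show ?thesis
      using osc_val_bounds(2)[of "(psum \<sigma> n \<omega> / sqrt n - (c + \<eta>)) / sqrt \<delta>"]
        osc_val_bounds(1)[of "- (\<eta> / sqrt \<delta>)"] by simp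
  qed
  have "value_at a b \<sigma> n (c + \<eta>) \<delta> n - osc_val a b (- (\<eta> / sqrt \<delta>))
      = expectation (\<lambda>\<omega>. ?V \<omega> - osc_val a b (- (\<eta> / sqrt \<delta>)))"
    unfolding value_at_n[OF n] using integrable_osc_val[OF osc \<sigma>] by (simp add: prob_space)
  also have "\<dots> \<le> expectation (indicator A)"
    using integrable_osc_val[OF osc \<sigma>] ind int_A
    by (intro integral_mono Bochner_Integration.integrable_diff) auto
  also have "\<dots> = prob A"
    using \<open>A \<in> sets M\<close> by simp
  finally have "value_at a b \<sigma> n (c + \<eta>) \<delta> n - osc_val a b (- (\<eta> / sqrt \<delta>)) \<le> prob A" .
  moreover have "value_at a b \<sigma> n (c + \<eta>) \<delta> n \<ge> osc_val a b ((- \<eta> - c) / sqrt (1 + \<delta>))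
      - step_const a b \<delta> m * sqrt (1 / n)"
    using value_at_lower[OF osc \<sigma> n \<delta> order_refl opt] n
    unfolding value_at_0 by (simp add: add.commute)
  moreover have "osc_val a b (- (\<eta> / sqrt \<delta>)) \<le> 2 * Phi (- (\<eta> / sqrt \<delta>) / b)"
    using \<delta> \<eta> by (intro osc_val_tails) auto
  moreover have "osc_val a b ((- \<eta> - c) / sqrt (1 + \<delta>)) \<ge> 2 * b / (a + b) * Phi (- c / b)
      - (\<eta> + c * (1 - 1 / sqrt (1 + \<delta>))) / b"
    using osc_val_perturbed[OF c, of \<delta> "- \<eta>" \<eta>] \<delta> \<eta> by (simp add: abs_le_iff)
  ultimately have "prob A \<ge> 2 * b / (a + b) * Phi (- c / b) - gap b c \<delta> \<eta>
      - step_const a b \<delta> m * sqrt (1 / n)"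
    unfolding gap_def by linarith
  then show "prob {\<omega> \<in> space M. sqrt n * sample_mean (\<lambda>i \<omega>. \<sigma> i \<omega> * e i \<omega>) n \<omega> > c}
    \<ge> 2 * b / (a + b) * Phi (- c / b) - gap b c \<delta> \<eta> - step_const a b \<delta> m * sqrt (1 / n)"
    unfolding A_def scaled_mean_eq_psum[OF n] .
qed

lemma sup_prob_close:
  assumes osc: "0 < a" "a \<le> b" and l: "0 \<le> l" "l \<le> a"
    and n: "0 < n" and \<delta>: "0 < \<delta>" and c: "0 \<le> c" and \<eta>: "0 \<le> \<eta>"
  shows "\<bar>(SUP \<sigma>\<in>predictable_seqs M e l b.
      prob {\<omega> \<in> space M. sqrt n * sample_mean (\<lambda>i \<omega>. \<sigma> i \<omega> * e i \<omega>) n \<omega> > c})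
    - 2 * b / (a + b) * Phi (- c / b)\<bar>
    \<le> gap b c \<delta> \<eta> + (a - l) / (\<delta> * b) + step_const a b \<delta> m * sqrt (1 / n)"
proof -
  let ?p = "\<lambda>\<sigma>. prob {\<omega> \<in> space M. sqrt n * sample_mean (\<lambda>i \<omega>. \<sigma> i \<omega> * e i \<omega>) n \<omega> > c}"
  let ?L = "2 * b / (a + b) * Phi (- c / b)"
  obtain \<sigma> where \<sigma>: "\<sigma> \<in> predictable_seqs M e l b"
    "?p \<sigma> \<ge> ?L - gap b c \<delta> \<eta> - step_const a b \<delta> m * sqrt (1 / n)"
    using prob_lower[OF osc l(2) n \<delta> c \<eta>] by blast
  have "?p \<sigma> \<le> (SUP \<sigma>\<in>predictable_seqs M e l b. ?p \<sigma>)"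
    using \<sigma>(1) by (intro cSUP_upper bdd_aboveI2[where M = 1]) auto
  moreover have "(SUP \<sigma>\<in>predictable_seqs M e l b. ?p \<sigma>) \<le> ?L + gap b c \<delta> \<eta> + (a - l) / (\<delta> * b)
      + step_const a b \<delta> m * sqrt (1 / n)"
    using \<sigma>(1) by (intro cSUP_least prob_upper assms) auto
  \<comment> \<open>The lower estimate lacks this term; being nonnegative, it may be added to obtain
    one two-sided bound.\<close>
  moreover have "0 \<le> (a - l) / (\<delta> * b)"
    using assms by auto
  ultimately show ?thesis
    using \<sigma>(2) unfolding abs_le_iff by linarith
qed

section \<open>Passage to the limit\<close>

lemma gap_tendsto_0:
  assumes "0 < b"
  shows "((\<lambda>r. gap b c (r ^ 4) r) \<longlongrightarrow> 0) (at_right 0)"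
proof -
  have "((\<lambda>r. Phi (- (1 / b) * inverse r)) \<longlongrightarrow> 0) (at_right 0)"
    using assms
    by (intro filterlim_compose[OF std_normal.cdf_lim_at_bot]
        filterlim_tendsto_neg_mult_at_bot[OF tendsto_const] filterlim_inverse_at_top_right) auto
  \<comment> \<open>Since \<open>sqrt (r ^ 4)\<close> is \<open>r^2\<close>, the tail is taken at
    distance \<open>1 / r\<close>.\<close>
  moreover have "eventually (\<lambda>r. Phi (- (1 / b) * inverse r) = Phi (- (r / sqrt (r ^ 4)) / b)) (at_right 0)"
    using eventually_at_right_less
  proof eventually_elim
    case (elim r)
    have "sqrt (r ^ 4) = r\<^sup>2"
      by (rule real_sqrt_unique) auto
    then show ?case
      using elim by (simp add: power2_eq_square field_simps)
  qed
  ultimately have "((\<lambda>r. Phi (- (r / sqrt (r ^ 4)) / b)) \<longlongrightarrow> 0) (at_right 0)"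
    by (rule Lim_transform_eventually)
  then show ?thesis
    unfolding gap_def using assms by (auto intro!: tendsto_eq_intros)
qed

text \<open>First \<open>r\<close> is fixed so that all errors independent of \<open>n\<close> fall
  below \<open>\<zeta> / 2\<close>, including the change of the limit from \<open>l\<close> to
  \<open>l + r ^ 5\<close>. Only then is \<open>n\<close> taken large, since
  \<open>step_const\<close> depends on \<open>r\<close>. As \<open>l + r ^ 5\<close> is positive,
  \<open>l = 0\<close> is covered as well.\<close>

lemma sup_prob_tendsto:
  assumes l: "0 \<le> l" "l < b" and c: "0 \<le> c"
  shows "(\<lambda>n. SUP \<sigma>\<in>predictable_seqs M e l b.
      prob {\<omega> \<in> space M. sqrt n * sample_mean (\<lambda>i \<omega>. \<sigma> i \<omega> * e i \<omega>) n \<omega> > c})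
    \<longlonglongrightarrow> 2 * b / (l + b) * Phi (- c / b)"
    (is "?s \<longlonglongrightarrow> ?L l")
proof (rule LIMSEQ_I)
  fix \<zeta> :: real assume \<zeta>: "0 < \<zeta>"
  have b: "0 < b" using l by simp
  \<comment> \<open>Stopping \<open>\<delta> = r\<^sup>4\<close> early, barrier shift \<open>\<eta> = r\<close> and \<open>a = l + r\<^sup>5\<close>: then \<open>\<eta> / sqrt \<delta>\<close> tends to infinity
    while \<open>(a - l) / \<delta>\<close> vanishes as \<open>r\<close> decreases to \<open>0\<close>.\<close>
  define G where "G = (\<lambda>r. gap b c (r ^ 4) r + r / b + \<bar>?L (l + r ^ 5) - ?L l\<bar>)"
  have "(G \<longlongrightarrow> 0) (at_right 0)"
    unfolding G_def using l b by (auto intro!: tendsto_eq_intros gap_tendsto_0)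
  moreover have "((\<lambda>r. l + r ^ 5) \<longlongrightarrow> l) (at_right 0)"
    by (auto intro!: tendsto_eq_intros)
  ultimately have "eventually (\<lambda>r. G r < \<zeta> / 2 \<and> l + r ^ 5 < b \<and> 0 < r) (at_right 0)"
    using \<zeta> l by (intro eventually_conj order_tendstoD(2)[where y = 0] order_tendstoD(2)[where y = l]
        eventually_at_right_less) auto
  then obtain r where r: "G r < \<zeta> / 2" "l + r ^ 5 < b" "0 < r"
    using eventually_happens by fastforce
  define K where "K = step_const (l + r ^ 5) b (r ^ 4) m"
  have "(\<lambda>n. K * sqrt (1 / real n)) \<longlonglongrightarrow> K * sqrt 0"
    by (intro tendsto_intros lim_1_over_n)
  then have "eventually (\<lambda>n. K * sqrt (1 / real n) < \<zeta> / 2) sequentially"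
    using \<zeta> by (intro order_tendstoD(2)) auto
  then obtain N where N: "\<And>n. N \<le> n \<Longrightarrow> K * sqrt (1 / real n) < \<zeta> / 2"
    unfolding eventually_sequentially by blast
  have "norm (?s n - ?L l) < \<zeta>" if n: "max N 1 \<le> n" for n
  proof -
    have "\<bar>?s n - ?L (l + r ^ 5)\<bar> \<le> gap b c (r ^ 4) r + (l + r ^ 5 - l) / (r ^ 4 * b) + K * sqrt (1 / n)"
      unfolding K_def using l c r n by (intro sup_prob_close) (auto intro: add_nonneg_pos)
    also have "(l + r ^ 5 - l) / (r ^ 4 * b) = r / b"
      using r by (simp add: power_numeral_reduce)
    finally have "\<bar>?s n - ?L l\<bar> \<le> G r + K * sqrt (1 / n)"
      unfolding G_def by linarith
    then show ?thesis
      using r(1) N[of n] n by simp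
  qed
  then show "\<exists>no. \<forall>n\<ge>no. norm (?s n - ?L l) < \<zeta>" by blast
qed

end

theorem mainTheorem5:
  fixes M :: "'a measure" and \<epsilon> :: "nat \<Rightarrow> 'a \<Rightarrow> real"
    and \<sigma>_lo \<sigma>_hi \<alpha> :: real
  assumes "prob_space M"
    and "iid_vars M \<epsilon> {1..}"
    and "\<And>i. i \<ge> 1 \<Longrightarrow> integral\<^sup>L M (\<epsilon> i) = 0"
    and "\<And>i. i \<ge> 1 \<Longrightarrow> integral\<^sup>L M (\<lambda>\<omega>. (\<epsilon> i \<omega>)\<^sup>2) = 1"
    and "\<And>i. i \<ge> 1 \<Longrightarrow> integrable M (\<lambda>\<omega>. \<bar>\<epsilon> i \<omega>\<bar> ^ 3)"
    and "0 \<le> \<sigma>_lo" and "\<sigma>_lo < \<sigma>_hi"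
    and "0 < \<alpha>" and "\<alpha> \<le> 1 / 2"
  shows "(\<lambda>n. SUP \<sigma>\<in>predictable_seqs M \<epsilon> \<sigma>_lo \<sigma>_hi.
            measure M {\<omega> \<in> space M.
              sqrt (real n) * sample_mean (\<lambda>i \<omega>. \<sigma> i \<omega> * \<epsilon> i \<omega>) n \<omega>
                > \<sigma>_hi * std_normal_quantile (1 - \<alpha>)})
           \<longlonglongrightarrow> 2 * \<alpha> / (1 + \<sigma>_lo / \<sigma>_hi)
         \<and> 2 * \<alpha> / (1 + \<sigma>_lo / \<sigma>_hi) > \<alpha>"
proof -
  interpret prob_space M by fact
  have indep: "indep_vars (\<lambda>_. borel) \<epsilon> {1..}"
    and distr: "\<And>i j. i \<in> {1..} \<Longrightarrow> j \<in> {1..} \<Longrightarrow> distr M borel (\<epsilon> i) = distr M borel (\<epsilon> j)"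
    using assms(2) unfolding iid_vars_def by blast+
  \<comment> \<open>Equal distributions make the third absolute moment of the first noise term a
    common bound.\<close>
  have third: "expectation (\<lambda>\<omega>. \<bar>\<epsilon> i \<omega>\<bar> ^ 3) \<le> expectation (\<lambda>\<omega>. \<bar>\<epsilon> 1 \<omega>\<bar> ^ 3)" if "1 \<le> i" for i
  proof -
    have rv: "\<epsilon> j \<in> borel_measurable M" if "1 \<le> j" for j
      using indep that unfolding indep_vars_def by auto
    have "expectation (\<lambda>\<omega>. \<bar>\<epsilon> j \<omega>\<bar> ^ 3) = (LINT x|distr M borel (\<epsilon> j). \<bar>x\<bar> ^ 3)" if "1 \<le> j" for j
      using rv[OF that] by (subst integral_distr) auto
    moreover have "distr M borel (\<epsilon> i) = distr M borel (\<epsilon> 1)"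
      using that by (intro distr) auto
    ultimately show ?thesis
      using that by simp
  qed
  interpret iid_noise M \<epsilon> "expectation (\<lambda>\<omega>. \<bar>\<epsilon> 1 \<omega>\<bar> ^ 3)"
    by unfold_locales (rule indep assms(3-5) third; assumption?)+
  let ?q = "std_normal_quantile (1 - \<alpha>)"
  have hi: "0 < \<sigma>_hi"
    using assms by simp
  \<comment> \<open>As \<alpha> is at most 1/2, the threshold is nonnegative, so the walk starts on
    the lower piece of \<open>osc_val\<close>.\<close>
  have "0 \<le> ?q"
    using assms by (intro quantile_nonneg) auto
  then have c: "0 \<le> \<sigma>_hi * ?q"
    using hi by simp
  have "Phi (- (\<sigma>_hi * ?q) / \<sigma>_hi) = \<alpha>"
    using hi assms Phi_quantile[of "1 - \<alpha>"] by (simp add: Phi_minus)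
  moreover have "2 * \<sigma>_hi / (\<sigma>_lo + \<sigma>_hi) * \<alpha> = 2 * \<alpha> / (1 + \<sigma>_lo / \<sigma>_hi)"
    using hi assms by (simp add: field_simps)
  ultimately have "2 * \<sigma>_hi / (\<sigma>_lo + \<sigma>_hi) * Phi (- (\<sigma>_hi * ?q) / \<sigma>_hi) = 2 * \<alpha> / (1 + \<sigma>_lo / \<sigma>_hi)"
    by simp
  moreover have "\<alpha> < 2 * \<alpha> / (1 + \<sigma>_lo / \<sigma>_hi)"
    using hi assms by (simp add: field_simps)
  ultimately show ?thesis
    using sup_prob_tendsto[OF assms(6,7) c] by simp
qed

end
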